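(* Let $\lambda>0$ be a real number. If the rectangle $1\times\lambda$ can be covered on both sides in one layer by finitely many squares without gaps or overlaps, then $\lambda = p \pm \sqrt{q^2-r^2}$ for some rational numbers $p \ge q \ge r \ge 0$.
   Context: Let $G=\{(m,n\lambda): m,n\in\mathbb{Z}\}$. Two points of the plane are called complexly equivalent if one can be obtained from the other by a composition of central symmetries (point reflections) about points of $G$. A covering of the rectangle $1\times\lambda$ on both sides in one layer by squares is a finite set $\Gamma_2$ of squares in the plane with pairwise disjoint interiors such that (1) every point of the plane is complexly equivalent to some point of the union of the squares of $\Gamma_2$, and (2) no two distinct points of the interior of the union of the squares of $\Gamma_2$ are complexly equivalent. *)

theory Defs
  imports "HOL-Analysis.Analysis"
begin

text \<open>The plane is identified with the type of complex numbers; the point \<open>(a, b)\<close> is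
  \<open>Complex a b\<close>.\<close>

definition grid :: "real \<Rightarrow> complex set" where
  "grid lam = {Complex (of_int m) (of_int n * lam) | m n :: int. True}"

definition central_symmetry :: "complex \<Rightarrow> complex \<Rightarrow> complex" where
  "central_symmetry c z = 2 * c - z"

definition complexly_equivalent :: "real \<Rightarrow> complex \<Rightarrow> complex \<Rightarrow> bool" where
  "complexly_equivalent lam z w \<longleftrightarrow>
     (\<exists>cs. set cs \<subseteq> grid lam \<and> w = fold central_symmetry cs z)"

text \<open>Closed nondegenerate squares of arbitrary orientation: the vertices are listed
  counterclockwise from \<open>a\<close>, with first side the vector \<open>v\<close>; multiplication by
  \<open>\<i>\<close> is the rotation by a right angle.\<close>

definition is_square :: "complex set \<Rightarrow> bool" where
  "is_square S \<longleftrightarrow>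
     (\<exists>a v. v \<noteq> 0 \<and> S = convex hull {a, a + v, a + v + \<i> * v, a + \<i> * v})"

definition two_sided_covering :: "real \<Rightarrow> complex set set \<Rightarrow> bool" where
  "two_sided_covering lam \<Gamma> \<longleftrightarrow>
     finite \<Gamma> \<and>
     (\<forall>S\<in>\<Gamma>. is_square S) \<and>
     (\<forall>S\<in>\<Gamma>. \<forall>T\<in>\<Gamma>. S \<noteq> T \<longrightarrow> interior S \<inter> interior T = {}) \<and>
     (\<forall>z. \<exists>w\<in>\<Union>\<Gamma>. complexly_equivalent lam z w) \<and>
     (\<forall>z\<in>interior (\<Union>\<Gamma>). \<forall>w\<in>interior (\<Union>\<Gamma>). z \<noteq> w \<longrightarrow> \<not> complexly_equivalent lam z w)"

end

theory Submission
  imports Defs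
begin

text \<open>
  The images of the squares under the group of symmetries tile the plane. Two squares that touch at a
  point which is a corner of neither have parallel sides; since the plane without the countably many
  corners is connected, all squares are parallel. In coordinates along their sides the lattice of
  translations is generated by \<open>(c, - s)\<close> and \<open>(lam * s, lam * c)\<close>. In the spirit of Dehn, every pair
  of additive functions \<open>\<phi>\<close>, \<open>\<psi>\<close> gives a translation invariant finitely additive measure of
  half-open boxes; comparing the squares of side \<open>r\<close> with an \<open>L\<close>-shaped fundamental domain gives
  \<open>2 * (\<Sum>\<phi> r * \<psi> r) = \<phi> c * \<psi> (lam * c) + \<phi> (lam * s) * \<psi> s\<close>. Thus the right-hand side is symmetric
  and positive semidefinite on rational-linear functions. For irrational \<open>lam\<close>, symmetry puts \<open>s\<close> and
  \<open>lam * s\<close> into the rational span of \<open>c\<close> and \<open>lam * c\<close>, so \<open>lam\<close> is quadratic, and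
  semidefiniteness makes its conjugate positive.
\<close>

subsection \<open>Finitely additive measures of boxes\<close>

text \<open>The value 0 for \<open>b \<le> a\<close> makes empty intervals count as nothing, so
  intersections of boxes need no case distinction when they are empty.\<close>

definition increment :: "(real \<Rightarrow> real) \<Rightarrow> real \<Rightarrow> real \<Rightarrow> real" where
  "increment \<phi> a b = (if a < b then \<phi> b - \<phi> a else 0)"

text \<open>The step function vanishes identically, hence so does its jump at every
  \<open>t\<close>, which is the total weight of the indices with \<open>e k = t\<close>. Grouping
  the sum by the values of \<open>e\<close> finishes.\<close>

lemma sum_weighted_eq_0_if_steps_cancel:
  fixes e d :: "'k \<Rightarrow> real"
  assumes K: "finite K" and steps: "\<And>x. (\<Sum>k\<in>K. if e k \<le> x then d k else 0) = 0"
  shows "(\<Sum>k\<in>K. d k * \<phi> (e k)) = 0"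
proof -
  have level: "(\<Sum>k\<in>{k\<in>K. e k = t}. d k) = 0" for t
  proof -
    \<comment> \<open>No value of \<open>e\<close> lies strictly between \<open>x\<close> and
      \<open>t\<close>, so the step functions at \<open>t\<close> and at \<open>x\<close> differ
      exactly by the weights at \<open>t\<close>. The entry \<open>t - 1\<close> keeps the set
      nonempty.\<close>
    define x where "x = Max (insert (t - 1) (e ` {k\<in>K. e k < t}))"
    have "x < t" using K unfolding x_def by (subst Max_less_iff) auto
    moreover have "e k \<le> x" if "k \<in> K" "e k < t" for k
      using K that unfolding x_def by (intro Max_ge) auto
    ultimately have "(if e k = t then d k else 0)
        = (if e k \<le> t then d k else 0) - (if e k \<le> x then d k else 0)" if "k \<in> K" for k
      using that by force
    hence "(\<Sum>k\<in>K. if e k = t then d k else 0) = 0"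
      by (simp add: sum_subtractf steps)
    thus ?thesis using K by (simp add: sum.If_cases Int_def)
  qed
  have "(\<Sum>k\<in>K. d k * \<phi> (e k)) = (\<Sum>t\<in>e ` K. \<Sum>k\<in>{k\<in>K. e k = t}. d k * \<phi> (e k))"
    by (rule sum.image_gen[OF K])
  also have "\<dots> = (\<Sum>t\<in>e ` K. (\<Sum>k\<in>{k\<in>K. e k = t}. d k) * \<phi> t)"
    by (intro sum.cong refl) (simp add: sum_distrib_right)
  finally show ?thesis by (simp add: level)
qed

text \<open>The indicator of a nonempty half-open interval is the step at its left end minus the
  step at its right end. The Boolean component of an index selects the endpoint.\<close>

lemma sum_increment_eq_0:
  assumes K: "finite K" and cancel: "\<And>x. (\<Sum>k\<in>K. c k * indicator {a k..<b k} x) = (0::real)"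
  shows "(\<Sum>k\<in>K. c k * increment \<phi> (a k) (b k)) = 0"
proof -
  define e where "e = (\<lambda>(k, r). if r then a k else b k)"
  define d where "d = (\<lambda>(k, r). if a k < b k then (if r then c k else - c k) else 0)"
  have pairs: "(\<Sum>p\<in>K \<times> UNIV. h p) = (\<Sum>k\<in>K. h (k, True) + h (k, False))" for h :: "_ \<Rightarrow> real"
    by (simp add: sum.cartesian_product' UNIV_bool add.commute)
  have "(\<Sum>p\<in>K \<times> UNIV. d p * \<phi> (e p)) = 0"
  proof (rule sum_weighted_eq_0_if_steps_cancel[where e = e and d = d and \<phi> = \<phi>])
    fix x
    have "(\<Sum>p\<in>K \<times> UNIV. if e p \<le> x then d p else 0) = (\<Sum>k\<in>K. c k * indicator {a k..<b k} x)"
      unfolding pairs by (intro sum.cong refl) (auto simp: e_def d_def indicator_def)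
    thus "(\<Sum>p\<in>K \<times> UNIV. if e p \<le> x then d p else 0) = 0" by (simp add: cancel)
  qed (use K in auto)
  also have "(\<Sum>p\<in>K \<times> UNIV. d p * \<phi> (e p)) = - (\<Sum>k\<in>K. c k * increment \<phi> (a k) (b k))"
    unfolding pairs sum_negf[symmetric] by (intro sum.cong refl) (auto simp: e_def d_def increment_def algebra_simps)
  finally show ?thesis by simp
qed

text \<open>Half-open boxes are closed under intersection and can partition the plane without
  ambiguity on common edges.\<close>

definition hbox :: "complex \<Rightarrow> complex \<Rightarrow> complex set" where
  "hbox lo hi = {z. Re z \<in> {Re lo..<Re hi} \<and> Im z \<in> {Im lo..<Im hi}}"

text \<open>For additive \<open>\<phi>\<close> and \<open>\<psi>\<close> this is the value of \<open>\<phi> \<otimes> \<psi>\<close> on the tensor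
  width \<open>\<otimes>\<close> height.\<close>

definition hmeasure :: "(real \<Rightarrow> real) \<Rightarrow> (real \<Rightarrow> real) \<Rightarrow> complex \<Rightarrow> complex \<Rightarrow> real" where
  "hmeasure \<phi> \<psi> lo hi = increment \<phi> (Re lo) (Re hi) * increment \<psi> (Im lo) (Im hi)"

lemma indicator_hbox:
  "indicator (hbox lo hi) z = (indicator {Re lo..<Re hi} (Re z) * indicator {Im lo..<Im hi} (Im z) :: real)"
  by (auto simp: hbox_def indicator_def)

text \<open>A discrete form of Fubini: on each horizontal line the one-dimensional lemma applies in
  the real part; the result is a vanishing combination of intervals in the imaginary part, to which
  it applies again.\<close>

lemma sum_hmeasure_eq_0:
  assumes K: "finite K" and cancel: "\<And>z. (\<Sum>k\<in>K. c k * indicator (hbox (lo k) (hi k)) z) = (0::real)"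
  shows "(\<Sum>k\<in>K. c k * hmeasure \<phi> \<psi> (lo k) (hi k)) = 0"
proof -
  have "(\<Sum>k\<in>K. (c k * increment \<phi> (Re (lo k)) (Re (hi k))) * indicator {Im (lo k)..<Im (hi k)} y) = 0" for y
  proof -
    have "(\<Sum>k\<in>K. (c k * indicator {Im (lo k)..<Im (hi k)} y) * increment \<phi> (Re (lo k)) (Re (hi k))) = 0"
    proof (rule sum_increment_eq_0[OF K])
      show "(\<Sum>k\<in>K. c k * indicator {Im (lo k)..<Im (hi k)} y * indicator {Re (lo k)..<Re (hi k)} x) = 0" for x
        using cancel[of "Complex x y"] by (simp add: indicator_hbox mult_ac)
    qed
    thus ?thesis by (simp add: mult_ac)
  qed
  from sum_increment_eq_0[OF K this, of \<psi>] show ?thesis by (simp add: hmeasure_def mult_ac)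
qed

text \<open>The dissected box joins the pieces as an extra index \<open>None\<close> of weight - 1,
  so that the signed indicators cancel.\<close>

lemma hmeasure_additive:
  fixes lo hi :: "'k \<Rightarrow> complex"
  assumes K: "finite K"
    and dissection: "\<And>z. (\<Sum>k\<in>K. indicator (hbox (lo k) (hi k)) z) = (indicator (hbox lo' hi') z :: real)"
  shows "hmeasure \<phi> \<psi> lo' hi' = (\<Sum>k\<in>K. hmeasure \<phi> \<psi> (lo k) (hi k))"
proof -
  define c where "c = case_option (- 1 :: real) (\<lambda>_ :: 'k. 1)"
  define l where "l = case_option lo' lo"
  define h where "h = case_option hi' hi"
  have split: "(\<Sum>k\<in>insert None (Some ` K). f k) = f None + (\<Sum>k\<in>K. f (Some k))" for f :: "_ \<Rightarrow> real"
    using K by (simp add: sum.reindex)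
  have "(\<Sum>k\<in>insert None (Some ` K). c k * hmeasure \<phi> \<psi> (l k) (h k)) = 0"
    by (rule sum_hmeasure_eq_0) (use K in \<open>auto simp: split c_def l_def h_def dissection\<close>)
  thus ?thesis unfolding split by (simp add: c_def l_def h_def)
qed

text \<open>Together with \<open>meet_hi\<close> this gives the corners of an intersection of boxes.
  For disjoint boxes the corners may be out of order; \<open>hbox\<close> is then empty and
  \<open>hmeasure\<close> is 0.\<close>

definition meet_lo :: "complex \<Rightarrow> complex \<Rightarrow> complex" where
  "meet_lo z w = Complex (max (Re z) (Re w)) (max (Im z) (Im w))"

definition meet_hi :: "complex \<Rightarrow> complex \<Rightarrow> complex" where
  "meet_hi z w = Complex (min (Re z) (Re w)) (min (Im z) (Im w))"

lemma hbox_Int: "hbox lo hi \<inter> hbox lo' hi' = hbox (meet_lo lo lo') (meet_hi hi hi')"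
  by (auto simp: hbox_def meet_lo_def meet_hi_def)

lemma increment_translate:
  assumes "Modules.additive \<phi>"
  shows "increment \<phi> (a + t) (b + t) = increment \<phi> a b"
  using assms by (simp add: increment_def Modules.additive.add)

lemma hmeasure_translate:
  assumes "Modules.additive \<phi>" "Modules.additive \<psi>"
  shows "hmeasure \<phi> \<psi> (lo + g) (hi + g) = hmeasure \<phi> \<psi> lo hi"
  using assms by (simp add: hmeasure_def increment_translate)

lemma mem_hbox_translate: "z \<in> hbox (lo + g) (hi + g) \<longleftrightarrow> z - g \<in> hbox lo hi"
  by (auto simp: hbox_def algebra_simps)

lemma hbox_subset_cbox: "hbox lo hi \<subseteq> cbox lo hi"
  by (auto simp: hbox_def in_cbox_complex_iff)

section \<open>Tilings by translates of finitely many boxes\<close>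

lemma boxes_bounded:
  fixes lo hi :: "'i \<Rightarrow> complex"
  assumes "finite I"
  obtains M where "\<And>i z. i \<in> I \<Longrightarrow> z \<in> cbox (lo i) (hi i) \<Longrightarrow> norm z \<le> M"
proof -
  have "bounded (\<Union>i\<in>I. cbox (lo i) (hi i))" using assms by auto
  then obtain M where "\<forall>z\<in>(\<Union>i\<in>I. cbox (lo i) (hi i)). norm z \<le> M" by (auto simp: bounded_iff)
  thus thesis using that by blast
qed

text \<open>Uniqueness is required of the pair of index and translation, so different translates of
  the same box are disjoint as well.\<close>

definition lattice_tiling :: "complex set \<Rightarrow> 'i set \<Rightarrow> ('i \<Rightarrow> complex) \<Rightarrow> ('i \<Rightarrow> complex) \<Rightarrow> bool" where
  "lattice_tiling L I lo hi \<longleftrightarrow>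
     (\<forall>z. \<exists>!p. p \<in> I \<times> L \<and> z - snd p \<in> hbox (lo (fst p)) (hi (fst p)))"

lemma sum_indicator_eq_1:
  assumes "finite A" "\<exists>!p. p \<in> A \<and> f p \<in> B p"
  shows "(\<Sum>p\<in>A. indicator (B p) (f p)) = (1::real)"
proof -
  obtain p where p: "p \<in> A" "f p \<in> B p" "\<And>q. q \<in> A \<Longrightarrow> f q \<in> B q \<Longrightarrow> q = p"
    using assms(2) by (elim ex1E) blast
  have "(\<Sum>p\<in>A. indicator (B p) (f p)) = (\<Sum>q\<in>A. if q = p then 1 else (0::real))"
    by (intro sum.cong refl) (use p(2) in \<open>auto simp: indicator_def dest: p(3)\<close>)
  thus ?thesis using assms(1) p(1) by simp
qed

text \<open>\<open>K\<close> contains every translation that makes some tile meet the given box, so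
  finitely many translated tiles cut the box into pieces and additivity applies.\<close>

lemma lattice_tiling_dissects:
  assumes t: "lattice_tiling L I lo hi" and "finite I" "finite K" "K \<subseteq> L"
    and K: "\<And>i g z. i \<in> I \<Longrightarrow> g \<in> L \<Longrightarrow> z \<in> hbox lo' hi' \<Longrightarrow> z - g \<in> hbox (lo i) (hi i) \<Longrightarrow> g \<in> K"
  shows "hmeasure \<phi> \<psi> lo' hi' =
    (\<Sum>(i, g)\<in>I \<times> K. hmeasure \<phi> \<psi> (meet_lo (lo i + g) lo') (meet_hi (hi i + g) hi'))"
proof -
  have "hmeasure \<phi> \<psi> lo' hi' =
    (\<Sum>p\<in>I \<times> K. hmeasure \<phi> \<psi> (meet_lo (lo (fst p) + snd p) lo') (meet_hi (hi (fst p) + snd p) hi'))"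
  proof (rule hmeasure_additive)
    fix z
    show "(\<Sum>p\<in>I \<times> K. indicator (hbox (meet_lo (lo (fst p) + snd p) lo') (meet_hi (hi (fst p) + snd p) hi')) z)
        = (indicator (hbox lo' hi') z :: real)"
    proof (cases "z \<in> hbox lo' hi'")
      case True
      obtain p where p: "p \<in> I \<times> L" "z - snd p \<in> hbox (lo (fst p)) (hi (fst p))"
        "\<And>q. q \<in> I \<times> L \<Longrightarrow> z - snd q \<in> hbox (lo (fst q)) (hi (fst q)) \<Longrightarrow> q = p"
        using t[unfolded lattice_tiling_def, rule_format, of z] by (elim ex1E) blast
      have "(\<Sum>p\<in>I \<times> K. indicator (hbox (lo (fst p)) (hi (fst p))) (z - snd p)) = (1::real)"
      proof (rule sum_indicator_eq_1)
        have "p \<in> I \<times> K" using p(1,2) K[of "fst p" "snd p" z] True by (auto simp: mem_Times_iff)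
        thus "\<exists>!p. p \<in> I \<times> K \<and> z - snd p \<in> hbox (lo (fst p)) (hi (fst p))"
          using p(2,3) \<open>K \<subseteq> L\<close> by blast
      qed (use \<open>finite I\<close> \<open>finite K\<close> in simp_all)
      moreover have "(indicator (hbox (meet_lo (lo (fst p) + snd p) lo') (meet_hi (hi (fst p) + snd p) hi')) z :: real)
        = indicator (hbox (lo (fst p)) (hi (fst p))) (z - snd p)" for p :: "'a \<times> complex"
        using True by (simp add: hbox_Int[symmetric] indicator_def mem_hbox_translate)
      ultimately show ?thesis using True by simp
    qed (simp add: hbox_Int[symmetric])
  qed (use \<open>finite I\<close> \<open>finite K\<close> in simp_all)
  thus ?thesis by (simp add: case_prod_unfold)
qed

text \<open>The usual proof that two fundamental domains have equal measure: the tiles of each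
  system are cut by the translates of the other, and the pieces agree up to translations in
  \<open>L\<close>.\<close>

lemma lattice_tilings_equal_measure:
  assumes I: "finite I" "lattice_tiling L I lo hi" and J: "finite J" "lattice_tiling L J lo' hi'"
    and L: "\<And>g. g \<in> L \<Longrightarrow> - g \<in> L" "\<And>r. finite (L \<inter> cball 0 r)"
    and "Modules.additive \<phi>" "Modules.additive \<psi>"
  shows "(\<Sum>i\<in>I. hmeasure \<phi> \<psi> (lo i) (hi i)) = (\<Sum>j\<in>J. hmeasure \<phi> \<psi> (lo' j) (hi' j))"
proof -
  obtain M where M: "\<And>i z. i \<in> I \<Longrightarrow> z \<in> cbox (lo i) (hi i) \<Longrightarrow> norm z \<le> M"
    using boxes_bounded[OF I(1)] by blast
  obtain M' where M': "\<And>j z. j \<in> J \<Longrightarrow> z \<in> cbox (lo' j) (hi' j) \<Longrightarrow> norm z \<le> M'"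
    using boxes_bounded[OF J(1)] by blast
  \<comment> \<open>A translation that makes a box of one tiling meet a box of the other has norm at
    most \<open>M + M'\<close>. The ball is symmetric, so one \<open>K\<close> serves both
    directions.\<close>
  define K where "K = L \<inter> cball 0 (M + M')"
  have K: "g \<in> K" if "i \<in> I" "j \<in> J" "g \<in> L" "z \<in> hbox (lo i) (hi i)" "z + g \<in> hbox (lo' j) (hi' j)" for i j g z
  proof -
    have "norm z \<le> M" "norm (z + g) \<le> M'"
      using M[of i z] M'[of j "z + g"] that hbox_subset_cbox by blast+
    moreover have "norm g \<le> norm (z + g) + norm z"
      using norm_triangle_ineq4[of "z + g" z] by simp
    ultimately show ?thesis using that by (simp add: K_def)
  qed
  have "finite K" "K \<subseteq> L" using L(2) by (auto simp: K_def)
  have "(\<Sum>j\<in>J. hmeasure \<phi> \<psi> (lo' j) (hi' j))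
      = (\<Sum>j\<in>J. \<Sum>(i, g)\<in>I \<times> K. hmeasure \<phi> \<psi> (meet_lo (lo i + g) (lo' j)) (meet_hi (hi i + g) (hi' j)))"
  proof (rule sum.cong[OF refl])
    fix j assume "j \<in> J"
    have *: "g \<in> K" if "i \<in> I" "g \<in> L" "z \<in> hbox (lo' j) (hi' j)" "z - g \<in> hbox (lo i) (hi i)" for i g z
      using K[of i j g "z - g"] that \<open>j \<in> J\<close> by simp
    show "hmeasure \<phi> \<psi> (lo' j) (hi' j)
      = (\<Sum>(i, g)\<in>I \<times> K. hmeasure \<phi> \<psi> (meet_lo (lo i + g) (lo' j)) (meet_hi (hi i + g) (hi' j)))"
      by (rule lattice_tiling_dissects[OF I(2,1) \<open>finite K\<close> \<open>K \<subseteq> L\<close> *])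
  qed
  \<comment> \<open>Moving each piece back by \<open>g\<close> turns it from a part of box
    \<open>j\<close> into a part of box \<open>i\<close> without changing its measure.\<close>
  also have "\<dots> = (\<Sum>j\<in>J. \<Sum>i\<in>I. \<Sum>g\<in>K. hmeasure \<phi> \<psi> (meet_lo (lo' j + - g) (lo i)) (meet_hi (hi' j + - g) (hi i)))"
  proof -
    have "meet_lo (lo i + g) (lo' j) = meet_lo (lo' j + - g) (lo i) + g"
      "meet_hi (hi i + g) (hi' j) = meet_hi (hi' j + - g) (hi i) + g" for i j g
      by (simp_all add: meet_lo_def meet_hi_def complex_eq_iff max_def min_def)
    thus ?thesis
      using \<open>Modules.additive \<phi>\<close> \<open>Modules.additive \<psi>\<close> by (simp add: hmeasure_translate sum.cartesian_product)
  qed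
  also have "\<dots> = (\<Sum>j\<in>J. \<Sum>i\<in>I. \<Sum>g\<in>K. hmeasure \<phi> \<psi> (meet_lo (lo' j + g) (lo i)) (meet_hi (hi' j + g) (hi i)))"
  proof -
    have "(\<Sum>g\<in>K. hmeasure \<phi> \<psi> (meet_lo (lo' j + - g) (lo i)) (meet_hi (hi' j + - g) (hi i))) =
      (\<Sum>g\<in>K. hmeasure \<phi> \<psi> (meet_lo (lo' j + g) (lo i)) (meet_hi (hi' j + g) (hi i)))" for i j
      by (rule sum.reindex_bij_witness[of _ uminus uminus]) (auto simp: K_def L(1))
    thus ?thesis by (simp only:)
  qed
  also have "\<dots> = (\<Sum>i\<in>I. \<Sum>(j, g)\<in>J \<times> K. hmeasure \<phi> \<psi> (meet_lo (lo' j + g) (lo i)) (meet_hi (hi' j + g) (hi i)))"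
    by (subst sum.swap) (simp add: sum.cartesian_product)
  also have "\<dots> = (\<Sum>i\<in>I. hmeasure \<phi> \<psi> (lo i) (hi i))"
  proof (rule sum.cong[OF refl])
    fix i assume "i \<in> I"
    have *: "g \<in> K" if "j \<in> J" "g \<in> L" "z \<in> hbox (lo i) (hi i)" "z - g \<in> hbox (lo' j) (hi' j)" for j g z
      using K[of i j "- g" z] that L(1) \<open>i \<in> I\<close> by (auto simp: K_def)
    show "(\<Sum>(j, g)\<in>J \<times> K. hmeasure \<phi> \<psi> (meet_lo (lo' j + g) (lo i)) (meet_hi (hi' j + g) (hi i)))
      = hmeasure \<phi> \<psi> (lo i) (hi i)"
      by (rule lattice_tiling_dissects[OF J(2,1) \<open>finite K\<close> \<open>K \<subseteq> L\<close> *, symmetric])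
  qed
  finally show ?thesis by simp
qed

subsection \<open>Half-open tilings modulo a tilted lattice\<close>

lemma eventually_mem_box_if_mem_hbox:
  assumes "z \<in> hbox lo hi"
  shows "\<forall>\<^sub>F t in at_right 0. z + Complex t t \<in> box lo hi"
proof -
  have "\<forall>\<^sub>F t in at_right 0. t < min (Re hi - Re z) (Im hi - Im z)"
    by (rule eventually_at_rightI[of 0 "min (Re hi - Re z) (Im hi - Im z)"]) (use assms in \<open>auto simp: hbox_def\<close>)
  with eventually_at_right_less show ?thesis
    by eventually_elim (use assms in \<open>auto simp: hbox_def in_box_complex_iff\<close>)
qed

text \<open>A point to the left of or below the box stays there under small nudges; a point on or
  beyond an excluded right or upper edge is pushed further away.\<close>

lemma eventually_notin_cbox_if_notin_hbox:
  assumes "z \<notin> hbox lo hi"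
  shows "\<forall>\<^sub>F t in at_right 0. z + Complex t t \<notin> cbox lo hi"
proof -
  consider "Re z < Re lo" | "Im z < Im lo" | "Re hi \<le> Re z" | "Im hi \<le> Im z"
    using assms by (fastforce simp: hbox_def)
  thus ?thesis
  proof cases
    case 1
    thus ?thesis
      by (intro eventually_at_rightI[of 0 "Re lo - Re z"]) (auto simp: in_cbox_complex_iff)
  next
    case 2
    thus ?thesis
      by (intro eventually_at_rightI[of 0 "Im lo - Im z"]) (auto simp: in_cbox_complex_iff)
  qed (rule eventually_mono[OF eventually_at_right_less]; auto simp: in_cbox_complex_iff)+
qed

text \<open>Nudging a point diagonally turns half-open boxes into open ones and their complements into
  complements of closed ones, so a tiling up to boundaries becomes an exact one.\<close>

lemma lattice_tilingI:
  assumes "finite I" and fin: "\<And>r. finite (L \<inter> cball 0 r)"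
    and cover: "\<And>z. \<exists>i\<in>I. \<exists>g\<in>L. z - g \<in> cbox (lo i) (hi i)"
    and disjoint: "\<And>i j g h z. i \<in> I \<Longrightarrow> j \<in> I \<Longrightarrow> g \<in> L \<Longrightarrow> h \<in> L \<Longrightarrow>
      z - g \<in> box (lo i) (hi i) \<Longrightarrow> z - h \<in> box (lo j) (hi j) \<Longrightarrow> i = j \<and> g = h"
  shows "lattice_tiling L I lo hi"
  unfolding lattice_tiling_def
proof (intro allI)
  fix z
  have ex: "\<exists>p. p \<in> I \<times> L \<and> z - snd p \<in> hbox (lo (fst p)) (hi (fst p))"
  proof (rule ccontr)
    assume none: "\<nexists>p. p \<in> I \<times> L \<and> z - snd p \<in> hbox (lo (fst p)) (hi (fst p))"
    obtain M where M: "\<And>i z. i \<in> I \<Longrightarrow> z \<in> cbox (lo i) (hi i) \<Longrightarrow> norm z \<le> M"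
      using boxes_bounded[OF \<open>finite I\<close>] by blast
    \<comment> \<open>Only these finitely many tiles can contain \<open>z + Complex t t\<close> with
      \<open>0 < t < 1\<close>, since the nudge has norm at most 2. Hence a single \<open>t\<close>
      avoids them all, against \<open>cover\<close>.\<close>
    define P where "P = I \<times> (L \<inter> cball 0 (norm z + 2 + M))"
    have "finite P" using \<open>finite I\<close> fin by (simp add: P_def)
    have "\<forall>\<^sub>F t in at_right 0. \<forall>p\<in>P. (z - snd p) + Complex t t \<notin> cbox (lo (fst p)) (hi (fst p))"
      by (intro eventually_ball_finite[OF \<open>finite P\<close>] ballI eventually_notin_cbox_if_notin_hbox)
        (use none in \<open>auto simp: P_def\<close>)
    moreover have "\<forall>\<^sub>F t in at_right 0. t < (1::real)"
      by (rule eventually_at_rightI[of 0 1]) auto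
    ultimately have "\<forall>\<^sub>F t in at_right (0::real). False"
      using eventually_at_right_less[of 0]
    proof eventually_elim
      case (elim t)
      obtain i g where ig: "i \<in> I" "g \<in> L" "z + Complex t t - g \<in> cbox (lo i) (hi i)"
        using cover by blast
      have "norm (Complex t t) \<le> 2" using cmod_le[of "Complex t t"] elim by simp
      moreover have "norm (z + Complex t t - g) \<le> M" using M ig by blast
      moreover have "norm g \<le> norm z + norm (Complex t t) + norm (z + Complex t t - g)"
        using norm_triangle_ineq4[of "z + Complex t t" "z + Complex t t - g"]
          norm_triangle_ineq[of z "Complex t t"] by simp
      ultimately have "(i, g) \<in> P" using ig by (simp add: P_def)
      with elim(1) ig(3) show ?case by (auto simp: algebra_simps)
    qed
    thus False by (simp add: trivial_limit_at_right_real)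
  qed
  moreover have "p = q"
    if "p \<in> I \<times> L" "z - snd p \<in> hbox (lo (fst p)) (hi (fst p))"
      "q \<in> I \<times> L" "z - snd q \<in> hbox (lo (fst q)) (hi (fst q))" for p q
  proof -
    have "\<forall>\<^sub>F t in at_right (0::real). p = q"
      using eventually_mem_box_if_mem_hbox[OF that(2)] eventually_mem_box_if_mem_hbox[OF that(4)]
    proof eventually_elim
      case (elim t)
      thus ?case using disjoint[of "fst p" "fst q" "snd p" "snd q" "z + Complex t t"] that
        by (auto simp: algebra_simps prod_eq_iff)
    qed
    thus ?thesis by (simp add: trivial_limit_at_right_real)
  qed
  ultimately show "\<exists>!p. p \<in> I \<times> L \<and> z - snd p \<in> hbox (lo (fst p)) (hi (fst p))"
    by blast
qed

section \<open>A lattice with orthogonal generators and its L-shaped fundamental domain\<close>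

definition tilted_lattice :: "real \<Rightarrow> real \<Rightarrow> real \<Rightarrow> complex set" where
  "tilted_lattice c s lam =
     {of_int m * Complex c (- s) + of_int n * Complex (lam * s) (lam * c) | m n. True}"

text \<open>A fundamental domain of the tilted lattice: the \<open>L\<close>-shaped union of an upright
  \<open>c \<times> lam * c\<close> box and a \<open>lam * s \<times> s\<close> box attached at its upper right corner.\<close>

definition ell_lo :: "real \<Rightarrow> real \<Rightarrow> real \<Rightarrow> bool \<Rightarrow> complex" where
  "ell_lo c s lam k = (if k then 0 else Complex c (lam * c - s))"

definition ell_hi :: "real \<Rightarrow> real \<Rightarrow> real \<Rightarrow> bool \<Rightarrow> complex" where
  "ell_hi c s lam k = (if k then Complex c (lam * c) else Complex (c + lam * s) (lam * c))"

text \<open>\<open>X m n\<close> and \<open>Y m n\<close> are the coordinates of the point minus the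
  lattice vector with coefficients \<open>m\<close> and \<open>n\<close>. In each case the sign of
  \<open>n - n'\<close> and the horizontal bounds restrict the sign of \<open>m - m'\<close>, and
  then the vertical bounds fail. For two boxes of the same kind, exchanging them yields
  \<open>n = n'\<close>.\<close>

lemma ell_disjoint:
  fixes c s lam x y :: real and m n m' n' :: int
  assumes pos: "c > 0" "s \<ge> 0" "lam > 0"
  defines "X \<equiv> \<lambda>m n. x - of_int m * c - of_int n * (lam * s)"
  defines "Y \<equiv> \<lambda>m n. y + of_int m * s - of_int n * (lam * c)"
  shows "\<lbrakk>0 \<le> X m n; X m n < c; 0 \<le> Y m n; Y m n < lam * c;
      0 \<le> X m' n'; X m' n' < c; 0 \<le> Y m' n'; Y m' n' < lam * c\<rbrakk> \<Longrightarrow> n' \<le> n" (is "PROP ?A")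
    and "\<lbrakk>0 \<le> X m n; X m n < c; 0 \<le> Y m n; Y m n < lam * c;
      c \<le> X m' n'; X m' n' < c + lam * s; lam * c - s \<le> Y m' n'; Y m' n' < lam * c\<rbrakk> \<Longrightarrow> False" (is "PROP ?B")
    and "\<lbrakk>c \<le> X m n; X m n < c + lam * s; lam * c - s \<le> Y m n; Y m n < lam * c;
      c \<le> X m' n'; X m' n' < c + lam * s; lam * c - s \<le> Y m' n'; Y m' n' < lam * c\<rbrakk> \<Longrightarrow> n' \<le> n" (is "PROP ?C")
proof -
  define i j where "i = m - m'" and "j = n - n'"
  have X: "X m' n' = X m n + of_int i * c + of_int j * (lam * s)"
    and Y: "Y m' n' = Y m n - of_int i * s + of_int j * (lam * c)"
    by (simp_all add: X_def Y_def i_def j_def algebra_simps)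
  have up: "of_int j * (lam * s) \<ge> lam * s" "of_int j * (lam * c) \<ge> lam * c" if "j \<ge> 1"
    using that pos mult_right_mono[of 1 "real_of_int j" "lam * s"] mult_right_mono[of 1 "real_of_int j" "lam * c"]
    by simp_all
  have down: "of_int j * (lam * s) \<le> - (lam * s)" "of_int j * (lam * c) \<le> - (lam * c)" if "j \<le> - 1"
    using that pos mult_right_mono[of "real_of_int j" "- 1" "lam * s"] mult_right_mono[of "real_of_int j" "- 1" "lam * c"]
    by simp_all
  have down0: "of_int j * (lam * s) \<le> 0" "of_int j * (lam * c) \<le> 0" if "j \<le> 0"
    using that pos mult_right_mono[of "real_of_int j" 0 "lam * s"] mult_right_mono[of "real_of_int j" 0 "lam * c"]
    by simp_all
  have i_le: "i \<le> 0" if "of_int i * c < c"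
    using that pos mult_less_cancel_right_pos[of c "of_int i" 1] by simp
  have i_ge: "i \<ge> 0" if "of_int i * c > - c"
    using that pos mult_less_cancel_right_pos[of c "- 1" "of_int i"] by simp
  have i_gt: "i \<ge> 1" if "of_int i * c > 0"
    using that pos by (simp add: zero_less_mult_iff)
  have si: "i \<le> 0 \<Longrightarrow> of_int i * s \<le> 0" "i \<ge> 0 \<Longrightarrow> of_int i * s \<ge> 0" "i \<ge> 1 \<Longrightarrow> of_int i * s \<ge> s"
    using pos mult_right_mono[of 1 "real_of_int i" s] by (simp_all add: mult_nonpos_nonneg)
  have ls: "lam * s \<ge> 0" "lam * c > 0" using pos by auto
  show "PROP ?A"
  proof -
    assume A: "0 \<le> X m n" "X m n < c" "0 \<le> Y m n" "Y m n < lam * c"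
      "0 \<le> X m' n'" "X m' n' < c" "0 \<le> Y m' n'" "Y m' n' < lam * c"
    show "n' \<le> n"
    proof (rule ccontr)
      assume "\<not> n' \<le> n"
      hence j: "j \<le> - 1" by (simp add: j_def)
      hence "of_int i * c > - c" using A X down ls by linarith
      from si(2)[OF i_ge[OF this]] show False using down[OF j] A Y by linarith
    qed
  qed
  show "PROP ?B"
  proof -
    assume A: "0 \<le> X m n" "X m n < c" "0 \<le> Y m n" "Y m n < lam * c"
      "c \<le> X m' n'" "X m' n' < c + lam * s" "lam * c - s \<le> Y m' n'" "Y m' n' < lam * c"
    show False
    proof (cases "j \<ge> 1")
      case True
      hence "of_int i * c < c" using A X up ls by linarith
      from si(1)[OF i_le[OF this]] show False using up[OF True] A Y by linarith
    next
      case False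
      hence j: "j \<le> 0" by simp
      hence "of_int i * c > 0" using A X down0 pos by linarith
      from si(3)[OF i_gt[OF this]] show False using down0[OF j] A Y by linarith
    qed
  qed
  show "PROP ?C"
  proof -
    assume A: "c \<le> X m n" "X m n < c + lam * s" "lam * c - s \<le> Y m n" "Y m n < lam * c"
      "c \<le> X m' n'" "X m' n' < c + lam * s" "lam * c - s \<le> Y m' n'" "Y m' n' < lam * c"
    show "n' \<le> n"
    proof (rule ccontr)
      assume "\<not> n' \<le> n"
      hence j: "j \<le> - 1" by (simp add: j_def)
      hence "of_int i * c > 0" using A X down ls by linarith
      from si(3)[OF i_gt[OF this]] show False using down[OF j] A Y ls by linarith
    qed
  qed
qed

lemma int_crossing:
  fixes P :: "int \<Rightarrow> bool"
  assumes "P a" "\<not> P b" "a < b"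
  obtains n where "P n" "\<not> P (n + 1)"
proof -
  have "\<exists>n. P n \<and> \<not> P (n + 1)"
  proof (rule ccontr)
    assume "\<nexists>n. P n \<and> \<not> P (n + 1)"
    hence "P b" using assms(1,3) int_ge_induct[of a b P] by auto
    thus False using assms(2) by simp
  qed
  thus thesis using that by blast
qed

text \<open>For each \<open>n\<close> the coefficient \<open>\<mu> n\<close> puts the point into the
  vertical strip of the upright box. Its height there is nonnegative for very small \<open>n\<close>
  and negative for large \<open>n\<close>. At a sign change either the upright box contains the
  point, or the point lies in a gap that is filled by attached boxes.\<close>

lemma ell_covers:
  fixes c s lam x y :: real
  assumes pos: "c > 0" "s \<ge> 0" "lam > 0"
  defines "X \<equiv> \<lambda>m n. x - of_int m * c - of_int n * (lam * s)"
  defines "Y \<equiv> \<lambda>m n. y + of_int m * s - of_int n * (lam * c)"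
  shows "\<exists>m n. 0 \<le> X m n \<and> X m n < c \<and> 0 \<le> Y m n \<and> Y m n < lam * c \<or>
    c \<le> X m n \<and> X m n < c + lam * s \<and> lam * c - s \<le> Y m n \<and> Y m n < lam * c"
proof -
  define \<mu> where "\<mu> n = \<lfloor>(x - of_int n * (lam * s)) / c\<rfloor>" for n :: int
  have X\<mu>: "0 \<le> X (\<mu> n) n" "X (\<mu> n) n < c" for n
    using floor_divide_lower[OF pos(1), of "x - of_int n * (lam * s)"]
      floor_divide_upper[OF pos(1), of "x - of_int n * (lam * s)"]
    by (simp_all add: X_def \<mu>_def algebra_simps)
  \<comment> \<open>\<open>F\<close> is the area of a lattice cell. The linear form \<open>E\<close>
    is constant along the first generator and grows by \<open>F\<close> along the second, so
    \<open>n\<close> determines the height up to a bounded error.\<close>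
  define F where "F = lam * s\<^sup>2 + lam * c\<^sup>2"
  have "F > 0" using pos by (auto simp: F_def intro!: add_nonneg_pos)
  define E where "E = s * x + c * y"
  have cY: "c * Y m n = E - s * X m n - of_int n * F" for m n
    by (simp add: E_def X_def Y_def F_def algebra_simps power2_eq_square)
  have sX: "0 \<le> s * X (\<mu> n) n" "s * X (\<mu> n) n \<le> s * c" for n
    using X\<mu>[of n] pos by (auto intro: mult_left_mono)
  have "Y (\<mu> n) n \<ge> 0" if "of_int n * F \<le> E - s * c" for n
  proof -
    have "c * Y (\<mu> n) n \<ge> 0" using cY[of "\<mu> n" n] sX[of n] that by linarith
    thus ?thesis using pos by (simp add: zero_le_mult_iff)
  qed
  moreover have "of_int \<lfloor>(E - s * c) / F\<rfloor> * F \<le> E - s * c"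
    using floor_divide_lower[OF \<open>F > 0\<close>] by simp
  ultimately have start: "Y (\<mu> \<lfloor>(E - s * c) / F\<rfloor>) \<lfloor>(E - s * c) / F\<rfloor> \<ge> 0" by blast
  have "\<not> Y (\<mu> n) n \<ge> 0" if "of_int n * F > E" for n
  proof -
    have "c * Y (\<mu> n) n < 0" using cY[of "\<mu> n" n] sX[of n] that by linarith
    thus ?thesis using pos by (simp add: mult_less_0_iff)
  qed
  moreover have "of_int (\<lfloor>E / F\<rfloor> + 1) * F > E"
    using floor_divide_upper[OF \<open>F > 0\<close>] by simp
  ultimately have stop: "\<not> Y (\<mu> (\<lfloor>E / F\<rfloor> + 1)) (\<lfloor>E / F\<rfloor> + 1) \<ge> 0" by blast
  have "(E - s * c) / F \<le> E / F" using pos \<open>F > 0\<close> by (simp add: divide_right_mono)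
  hence "\<lfloor>(E - s * c) / F\<rfloor> < \<lfloor>E / F\<rfloor> + 1" using floor_mono by fastforce
  from int_crossing[of "\<lambda>n. Y (\<mu> n) n \<ge> 0", OF start stop this]
  obtain n where n: "Y (\<mu> n) n \<ge> 0" "Y (\<mu> (n + 1)) (n + 1) < 0" by (auto simp: not_le)
  show ?thesis
  proof (cases "Y (\<mu> n) n < lam * c")
    case True
    thus ?thesis using n X\<mu>[of n] by blast
  next
    case False
    have Yn: "Y (\<mu> (n + 1)) n < lam * c" using n(2) by (simp add: Y_def algebra_simps)
    have "s \<noteq> 0" using Yn False by (auto simp: Y_def)
    hence "s > 0" using pos by simp
    have step: "Y (m + 1) k = Y m k + s" for m k by (simp add: Y_def algebra_simps)
    have lt: "a < b" if "Y a n < Y b n" for a b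
      using that \<open>s > 0\<close> by (simp add: Y_def)
    have "\<mu> (n + 1) < \<mu> n" by (rule lt) (use Yn False in linarith)
    \<comment> \<open>Each step of \<open>m\<close> raises the height by \<open>s\<close>, so the
      crossing of \<open>lam * c\<close> places the point in the vertical range of the attached box.
      The position of \<open>m\<close> between \<open>\<mu> (n + 1)\<close> and
      \<open>\<mu> n\<close> gives the horizontal range.\<close>
    from int_crossing[of "\<lambda>m. Y m n < lam * c", OF Yn False this]
    obtain m where m: "Y m n < lam * c" "\<not> Y (m + 1) n < lam * c" by blast
    have "m < \<mu> n" using lt[of m "\<mu> n"] m False by simp
    hence 1: "c \<le> X m n"
      using X\<mu>(1)[of n] mult_right_mono[of "of_int m + 1" "of_int (\<mu> n)" c] pos
      by (simp add: X_def algebra_simps)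
    have "\<mu> (n + 1) < m + 1" using lt[of "\<mu> (n + 1)" "m + 1"] m Yn by simp
    hence le: "real_of_int (\<mu> (n + 1)) \<le> of_int m" by simp
    hence "X m n \<le> X (\<mu> (n + 1)) (n + 1) + lam * s"
      using pos by (simp add: X_def algebra_simps)
    hence 2: "X m n < c + lam * s" using X\<mu>(2)[of "n + 1"] by linarith
    show ?thesis using 1 2 m step[of m n] by (intro exI[of _ m] exI[of _ n]) auto
  qed
qed

lemma ell_tiling:
  assumes pos: "c > 0" "s \<ge> 0" "lam > 0"
  shows "lattice_tiling (tilted_lattice c s lam) UNIV (ell_lo c s lam) (ell_hi c s lam)"
  unfolding lattice_tiling_def
proof (intro allI)
  fix z
  define G where "G = (\<lambda>m n. of_int m * Complex c (- s) + of_int n * Complex (lam * s) (lam * c))"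
  define X where "X = (\<lambda>m n. Re z - of_int m * c - of_int n * (lam * s))"
  define Y where "Y = (\<lambda>m n. Im z + of_int m * s - of_int n * (lam * c))"
  have L: "tilted_lattice c s lam = {G m n | m n. True}" by (simp add: tilted_lattice_def G_def)
  have mem: "z - G m n \<in> hbox (ell_lo c s lam k) (ell_hi c s lam k) \<longleftrightarrow>
    (if k then 0 \<le> X m n \<and> X m n < c \<and> 0 \<le> Y m n \<and> Y m n < lam * c
     else c \<le> X m n \<and> X m n < c + lam * s \<and> lam * c - s \<le> Y m n \<and> Y m n < lam * c)" for m n k
    by (auto simp: hbox_def ell_lo_def ell_hi_def G_def X_def Y_def algebra_simps)
  have ex: "\<exists>k m n. z - G m n \<in> hbox (ell_lo c s lam k) (ell_hi c s lam k)"
    using ell_covers[OF pos, of "Re z" "Im z"] unfolding mem X_def Y_def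
    by (metis (full_types))
  \<comment> \<open>For fixed \<open>n\<close>, changing \<open>m\<close> by one moves the point by
    \<open>c\<close> horizontally and by \<open>s\<close> vertically. The upright box has width
    \<open>c\<close> and the attached box has height \<open>s\<close>, so \<open>m\<close> is unique
    in both.\<close>
  have col: "m' = m" if "0 \<le> X m n - a" "X m n - a < c" "0 \<le> X m' n - a" "X m' n - a < c" for m m' n a
  proof -
    have "of_int (m - m') * c < of_int 1 * c" "of_int (m' - m) * c < of_int 1 * c"
      using that by (simp_all add: X_def algebra_simps)
    thus ?thesis using pos by (simp only: mult_less_cancel_right_pos of_int_less_iff)
  qed
  have row: "m' = m" if "0 \<le> Y m n - a" "Y m n - a < s" "0 \<le> Y m' n - a" "Y m' n - a < s" for m m' n a
  proof -
    have "of_int (m - m') * s < of_int 1 * s" "of_int (m' - m) * s < of_int 1 * s"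
      using that by (simp_all add: Y_def algebra_simps)
    moreover have "s > 0" using that by linarith
    ultimately show ?thesis by (simp only: mult_less_cancel_right_pos of_int_less_iff)
  qed
  have uniq: "k = k' \<and> m = m' \<and> n = n'"
    if "z - G m n \<in> hbox (ell_lo c s lam k) (ell_hi c s lam k)"
      "z - G m' n' \<in> hbox (ell_lo c s lam k') (ell_hi c s lam k')" for k k' m m' n n'
  proof -
    note d = ell_disjoint[OF pos, where x = "Re z" and y = "Im z"]
    have d1: "n2 \<le> n1" if "0 \<le> X m1 n1" "X m1 n1 < c" "0 \<le> Y m1 n1" "Y m1 n1 < lam * c"
      "0 \<le> X m2 n2" "X m2 n2 < c" "0 \<le> Y m2 n2" "Y m2 n2 < lam * c" for m1 n1 m2 n2
      using that d(1) unfolding X_def Y_def by blast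
    have d2: "False" if "0 \<le> X m1 n1" "X m1 n1 < c" "0 \<le> Y m1 n1" "Y m1 n1 < lam * c"
      "c \<le> X m2 n2" "X m2 n2 < c + lam * s" "lam * c - s \<le> Y m2 n2" "Y m2 n2 < lam * c" for m1 n1 m2 n2
      using that d(2) unfolding X_def Y_def by blast
    have d3: "n2 \<le> n1" if "c \<le> X m1 n1" "X m1 n1 < c + lam * s" "lam * c - s \<le> Y m1 n1" "Y m1 n1 < lam * c"
      "c \<le> X m2 n2" "X m2 n2 < c + lam * s" "lam * c - s \<le> Y m2 n2" "Y m2 n2 < lam * c" for m1 n1 m2 n2
      using that d(3) unfolding X_def Y_def by blast
    show ?thesis
    proof (cases k; cases k')
      assume k: "k" "k'"
      have "n = n'" using that k d1[of m n m' n'] d1[of m' n' m n] unfolding mem by auto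
      thus ?thesis using that k col[of m n 0 m'] unfolding mem by auto
    next
      assume k: "\<not> k" "\<not> k'"
      have "n = n'" using that k d3[of m n m' n'] d3[of m' n' m n] unfolding mem by auto
      thus ?thesis using that k row[of m n "lam * c - s" m'] unfolding mem by auto
    next
      assume k: "k" "\<not> k'"
      thus ?thesis using that d2[of m n m' n'] unfolding mem by auto
    next
      assume k: "\<not> k" "k'"
      thus ?thesis using that d2[of m' n' m n] unfolding mem by auto
    qed
  qed
  obtain k m n where kmn: "z - G m n \<in> hbox (ell_lo c s lam k) (ell_hi c s lam k)" using ex by blast
  show "\<exists>!p. p \<in> UNIV \<times> tilted_lattice c s lam \<and>
    z - snd p \<in> hbox (ell_lo c s lam (fst p)) (ell_hi c s lam (fst p))"
  proof (rule ex1I[of _ "(k, G m n)"])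
    show "p = (k, G m n)" if p: "p \<in> UNIV \<times> tilted_lattice c s lam \<and>
      z - snd p \<in> hbox (ell_lo c s lam (fst p)) (ell_hi c s lam (fst p))" for p
    proof -
      obtain k' m' n' where "p = (k', G m' n')" using p L by (cases p) auto
      thus ?thesis using p uniq[of m' n' k' m n k] kmn by simp
    qed
  qed (use kmn L in auto)
qed

lemma tilted_lattice_uminus: "g \<in> tilted_lattice c s lam \<Longrightarrow> - g \<in> tilted_lattice c s lam"
proof -
  assume "g \<in> tilted_lattice c s lam"
  then obtain m n where "g = of_int m * Complex c (- s) + of_int n * Complex (lam * s) (lam * c)"
    by (auto simp: tilted_lattice_def)
  hence "- g = of_int (- m) * Complex c (- s) + of_int (- n) * Complex (lam * s) (lam * c)" by simp
  thus ?thesis unfolding tilted_lattice_def by blast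
qed

text \<open>The generators are orthogonal, so inner products with them recover the two integer
  coefficients up to constant factors; a bound on the vector therefore bounds both integers.\<close>

lemma finite_tilted_lattice_cball:
  assumes pos: "c > 0" "lam > 0"
  shows "finite (tilted_lattice c s lam \<inter> cball 0 r)"
proof -
  define R where "R = r * \<bar>c\<bar> + r * \<bar>s\<bar>"
  define F where "F = c\<^sup>2 + s\<^sup>2"
  have "F > 0" using pos by (auto simp: F_def intro: add_pos_nonneg)
  define G where "G = (\<lambda>(m, n). of_int m * Complex c (- s) + of_int n * Complex (lam * s) (lam * c))"
  have "tilted_lattice c s lam \<inter> cball 0 r \<subseteq>
    G ` ({- \<lceil>R / F\<rceil>..\<lceil>R / F\<rceil>} \<times> {- \<lceil>R / (lam * F)\<rceil>..\<lceil>R / (lam * F)\<rceil>})"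
  proof
    fix g assume g: "g \<in> tilted_lattice c s lam \<inter> cball 0 r"
    then obtain m n where mn: "g = G (m, n)" by (auto simp: tilted_lattice_def G_def)
    have r: "\<bar>Re g\<bar> \<le> r" "\<bar>Im g\<bar> \<le> r"
      using g abs_Re_le_cmod[of g] abs_Im_le_cmod[of g] by auto
    have "of_int m * F = c * Re g - s * Im g" "of_int n * (lam * F) = s * Re g + c * Im g"
      by (simp_all add: mn G_def F_def algebra_simps power2_eq_square)
    moreover have "\<bar>c * Re g\<bar> \<le> r * \<bar>c\<bar>" "\<bar>s * Im g\<bar> \<le> r * \<bar>s\<bar>"
      "\<bar>c * Im g\<bar> \<le> r * \<bar>c\<bar>" "\<bar>s * Re g\<bar> \<le> r * \<bar>s\<bar>"
      using r by (simp_all add: abs_mult mult.commute[of r] mult_left_mono)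
    ultimately have "\<bar>of_int m * F\<bar> \<le> R" "\<bar>of_int n * (lam * F)\<bar> \<le> R"
      unfolding R_def by linarith+
    hence "\<bar>real_of_int m\<bar> \<le> R / F" "\<bar>real_of_int n\<bar> \<le> R / (lam * F)"
      using \<open>F > 0\<close> pos by (simp_all add: field_simps abs_mult)
    hence "\<bar>m\<bar> \<le> \<lceil>R / F\<rceil>" "\<bar>n\<bar> \<le> \<lceil>R / (lam * F)\<rceil>" by linarith+
    thus "g \<in> G ` ({- \<lceil>R / F\<rceil>..\<lceil>R / F\<rceil>} \<times> {- \<lceil>R / (lam * F)\<rceil>..\<lceil>R / (lam * F)\<rceil>})"
      unfolding mn by (intro imageI) auto
  qed
  thus ?thesis by (rule finite_subset) auto
qed

text \<open>The tiling is compared with the L-shaped domain. The two products belong to its boxes of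
  size \<open>c\<close> by \<open>lam * c\<close> and \<open>lam * s\<close> by
  \<open>s\<close>.\<close>

lemma lattice_tiling_measure:
  assumes pos: "c > 0" "s \<ge> 0" "lam > 0"
    and "finite I" "lattice_tiling (tilted_lattice c s lam) I lo hi"
    and \<phi>\<psi>: "Modules.additive \<phi>" "Modules.additive \<psi>"
  shows "(\<Sum>i\<in>I. hmeasure \<phi> \<psi> (lo i) (hi i)) = \<phi> c * \<psi> (lam * c) + \<phi> (lam * s) * \<psi> s"
proof -
  have "(\<Sum>i\<in>I. hmeasure \<phi> \<psi> (lo i) (hi i))
      = (\<Sum>k\<in>UNIV. hmeasure \<phi> \<psi> (ell_lo c s lam k) (ell_hi c s lam k))"
    by (rule lattice_tilings_equal_measure[OF assms(4,5) finite ell_tiling[OF pos]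
          tilted_lattice_uminus finite_tilted_lattice_cball[OF pos(1,3)] \<phi>\<psi>])
  also have "\<dots> = \<phi> c * \<psi> (lam * c) + \<phi> (lam * s) * \<psi> s"
  proof -
    have "increment f a (a + t) = f t" if "Modules.additive f" "t \<ge> 0" for f a t
      using that Modules.additive.zero[of f] by (auto simp: increment_def Modules.additive.add)
    from this[of \<phi> c 0] this[of \<psi> "lam * c" 0] this[of \<phi> "lam * s" c] this[of \<psi> s "lam * c - s"]
    show ?thesis using pos \<phi>\<psi> by (simp add: UNIV_bool hmeasure_def ell_lo_def ell_hi_def)
  qed
  finally show ?thesis .
qed

subsection \<open>Rational-linear functionals\<close>

text \<open>Positive semidefiniteness forces \<open>\<alpha> * \<gamma> \<ge> 0\<close>,
  \<open>\<beta> * \<delta> \<ge> 0\<close> and, through the discriminant, \<open>b \<le> 0\<close>,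
  hence \<open>\<beta> * \<gamma> < 0\<close>. So the quadratic equation of \<open>lam\<close> has
  roots with positive product and nonnegative sum, which gives \<open>0 < D < p * p\<close> for the
  roots \<open>p\<close> plus or minus the square root of \<open>D\<close>.\<close>

lemma quadratic_surd_form:
  fixes lam \<alpha> \<beta> \<gamma> \<delta> :: real
  assumes rat: "\<alpha> \<in> \<rat>" "\<beta> \<in> \<rat>" "\<gamma> \<in> \<rat>" "\<delta> \<in> \<rat>" and irr: "lam \<notin> \<rat>"
    and root: "lam * (\<alpha> + \<beta> * lam) = \<gamma> + \<delta> * lam"
    and det: "\<alpha> * \<delta> - \<beta> * \<gamma> = 1"
    and psd: "\<And>x y. x * y + (\<gamma> * x + \<delta> * y) * (\<alpha> * x + \<beta> * y) \<ge> 0"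
  shows "\<exists>p q r. p \<in> \<rat> \<and> q \<in> \<rat> \<and> r \<in> \<rat> \<and> p \<ge> q \<and> q \<ge> r \<and> r \<ge> 0 \<and>
           (lam = p + sqrt (q\<^sup>2 - r\<^sup>2) \<or> lam = p - sqrt (q\<^sup>2 - r\<^sup>2))"
proof -
  define b where "b = \<alpha> * \<delta>"
  have form: "\<alpha> * \<gamma> * x\<^sup>2 + 2 * b * x * y + \<beta> * \<delta> * y\<^sup>2 \<ge> 0" for x y
  proof -
    have "x * y + (\<gamma> * x + \<delta> * y) * (\<alpha> * x + \<beta> * y)
      = \<alpha> * \<gamma> * x\<^sup>2 + 2 * b * x * y + \<beta> * \<delta> * y\<^sup>2 + x * y * (1 - (\<alpha> * \<delta> - \<beta> * \<gamma>))"
      by (simp add: b_def algebra_simps power2_eq_square)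
    thus ?thesis using psd[of x y] det by simp
  qed
  have ag: "\<alpha> * \<gamma> \<ge> 0" and bd: "\<beta> * \<delta> \<ge> 0" using form[of 1 0] form[of 0 1] by simp_all
  have prod: "(\<alpha> * \<gamma>) * (\<beta> * \<delta>) = b * (b - 1)"
  proof -
    have "b - 1 = \<beta> * \<gamma>" using det by (simp add: b_def)
    thus ?thesis by (simp add: b_def mult_ac)
  qed
  have "b \<le> 0"
  proof (rule ccontr)
    assume "\<not> b \<le> 0"
    hence b: "b > 0" by simp
    \<comment> \<open>The discriminant test by substitution: at this point the form takes the value
      \<open>\<beta> * \<delta>\<close> times its determinant, and the determinant is
      \<open>- b\<close> by \<open>prod\<close>. If both diagonal coefficients vanish, the form is
      negative at \<open>(1, - 1)\<close>.\<close>
    have "(\<beta> * \<delta>) * (- b) \<ge> 0"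
    proof -
      have "\<alpha> * \<gamma> * (\<beta> * \<delta>)\<^sup>2 + 2 * b * (\<beta> * \<delta>) * (- b) + \<beta> * \<delta> * (- b)\<^sup>2
        = (\<beta> * \<delta>) * ((\<alpha> * \<gamma>) * (\<beta> * \<delta>) - b * b)" by (simp add: algebra_simps power2_eq_square)
      also have "\<dots> = (\<beta> * \<delta>) * (- b)" by (simp only: prod) (simp add: algebra_simps)
      finally show ?thesis using form[of "\<beta> * \<delta>" "- b"] by simp
    qed
    hence bd0: "\<beta> * \<delta> = 0" using bd mult_pos_pos[OF _ b, of "\<beta> * \<delta>"] by linarith
    have "(\<alpha> * \<gamma>) * (- b) \<ge> 0"
    proof -
      have "\<alpha> * \<gamma> * (- b)\<^sup>2 + 2 * b * (- b) * (\<alpha> * \<gamma>) + \<beta> * \<delta> * (\<alpha> * \<gamma>)\<^sup>2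
        = (\<alpha> * \<gamma>) * ((\<alpha> * \<gamma>) * (\<beta> * \<delta>) - b * b)" by (simp add: algebra_simps power2_eq_square)
      also have "\<dots> = (\<alpha> * \<gamma>) * (- b)" by (simp only: prod) (simp add: algebra_simps)
      finally show ?thesis using form[of "- b" "\<alpha> * \<gamma>"] by simp
    qed
    hence ag0: "\<alpha> * \<gamma> = 0" using ag mult_pos_pos[OF _ b, of "\<alpha> * \<gamma>"] by linarith
    show False using form[of 1 "- 1"] bd0 ag0 b by simp
  qed
  hence bg: "\<beta> * \<gamma> < 0" using det by (simp add: b_def)
  hence "\<beta> \<noteq> 0" by auto
  \<comment> \<open>\<open>p\<close> is half the sum of the roots of the equation for
    \<open>lam\<close>, and \<open>D\<close> is a quarter of the discriminant of the monic
    equation.\<close>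
  define p where "p = (\<delta> - \<alpha>) / (2 * \<beta>)"
  define D where "D = p\<^sup>2 + \<gamma> / \<beta>"
  have pD: "p \<in> \<rat>" "D \<in> \<rat>" using rat by (auto simp: p_def D_def)
  have "\<gamma> / \<beta> = \<beta> * \<gamma> / \<beta>\<^sup>2" by (simp add: power2_eq_square)
  hence gb: "\<gamma> / \<beta> < 0" using bg \<open>\<beta> \<noteq> 0\<close> by (simp add: divide_neg_pos)
  have "\<delta> / \<beta> = \<beta> * \<delta> / \<beta>\<^sup>2" by (simp add: power2_eq_square)
  hence db: "\<delta> / \<beta> \<ge> 0" using bd by simp
  have "\<gamma> \<noteq> 0" using bg by auto
  hence "\<alpha> / \<beta> = (\<alpha> * \<gamma>) * (\<beta> * \<gamma>) / (\<beta> * \<gamma>)\<^sup>2"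
    using \<open>\<beta> \<noteq> 0\<close> by (simp add: field_simps power2_eq_square)
  moreover have "(\<alpha> * \<gamma>) * (\<beta> * \<gamma>) \<le> 0" using ag bg by (simp add: mult_nonneg_nonpos)
  ultimately have ab: "\<alpha> / \<beta> \<le> 0" by (simp add: divide_nonpos_nonneg)
  have "p = (\<delta> / \<beta> - \<alpha> / \<beta>) / 2" using \<open>\<beta> \<noteq> 0\<close> by (simp add: p_def field_simps)
  hence "p \<ge> 0" using ab db by simp
  have "(lam - p)\<^sup>2 = D"
  proof -
    have "lam\<^sup>2 = 2 * p * lam + \<gamma> / \<beta>"
      using root \<open>\<beta> \<noteq> 0\<close> by (simp add: p_def field_simps power2_eq_square)
    thus ?thesis by (simp add: D_def power2_eq_square algebra_simps)
  qed
  moreover have "lam \<noteq> p" using irr pD by auto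
  ultimately have "D > 0" by (metis right_minus_eq zero_less_power2)
  have "p \<noteq> 0" using \<open>D > 0\<close> gb by (auto simp: D_def)
  hence "p > 0" using \<open>p \<ge> 0\<close> by simp
  \<comment> \<open>Writing \<open>D = p * e\<close> with \<open>0 < e < p\<close> makes
    \<open>D\<close> a difference of rational squares: half the sum and half the difference of
    \<open>p\<close> and \<open>e\<close> are the required \<open>q\<close> and
    \<open>r\<close>.\<close>
  define e where "e = D / p"
  have e: "0 < e" "e < p" "p * e = D"
    using \<open>p > 0\<close> \<open>D > 0\<close> gb by (simp_all add: e_def field_simps D_def power2_eq_square)
  define q r where "q = (p + e) / 2" and "r = (p - e) / 2"
  have "q\<^sup>2 - r\<^sup>2 = D"
    unfolding e(3)[symmetric] q_def r_def by (simp add: field_simps power2_eq_square)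
  moreover have "\<bar>lam - p\<bar> = sqrt D" using \<open>(lam - p)\<^sup>2 = D\<close> by (metis real_sqrt_abs)
  hence "lam = p + sqrt D \<or> lam = p - sqrt D" by linarith
  moreover have "q \<in> \<rat>" "r \<in> \<rat>" using pD by (auto simp: q_def r_def e_def)
  moreover have "p \<ge> q" "q \<ge> r" "r \<ge> 0"
    using e by (simp_all add: q_def r_def)
  ultimately show ?thesis
    using pD by (intro exI[of _ p] exI[of _ q] exI[of _ r]) simp
qed

interpretation real_over_rat: vector_space "\<lambda>(r :: rat) (x :: real). of_rat r * x"
  by unfold_locales (auto simp: algebra_simps of_rat_add of_rat_mult)

interpretation real_over_rat: vector_space_pair
  "\<lambda>(r :: rat) (x :: real). of_rat r * x" "\<lambda>(r :: rat) (x :: real). of_rat r * x"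
  by unfold_locales

abbreviation rat_linear :: "(real \<Rightarrow> real) \<Rightarrow> bool" where
  "rat_linear \<equiv> Vector_Spaces.linear (\<lambda>(r :: rat) (x :: real). of_rat r * x) (\<lambda>(r :: rat) (x :: real). of_rat r * x)"

lemma additive_if_rat_linear: "rat_linear f \<Longrightarrow> Modules.additive f"
  by unfold_locales (rule real_over_rat.linear_add)

lemma rat_linear_mult:
  assumes "rat_linear f" "q \<in> \<rat>"
  shows "f (q * x) = q * f x"
  using assms real_over_rat.linear_scale[of f] by (auto elim: Rats_cases)

lemma in_span_2:
  assumes "z \<in> real_over_rat.span {x, y}"
  obtains \<alpha> \<beta> where "\<alpha> \<in> \<rat>" "\<beta> \<in> \<rat>" "z = \<alpha> * x + \<beta> * y"
proof -
  from assms obtain a where "z - of_rat a * x \<in> real_over_rat.span {y}"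
    by (auto simp: real_over_rat.span_breakdown_eq)
  then obtain b where "z - of_rat a * x - of_rat b * y = 0"
    by (auto simp: real_over_rat.span_breakdown_eq)
  thus thesis by (intro that[of "of_rat a" "of_rat b"]) auto
qed

lemma independent_mult_irrational:
  assumes "x \<noteq> 0" "lam \<notin> \<rat>"
  shows "real_over_rat.independent {x, lam * x}" "x \<noteq> lam * x"
proof -
  have "lam \<noteq> 1" "lam \<noteq> 0" using assms(2) by auto
  show ne: "x \<noteq> lam * x" using assms(1) \<open>lam \<noteq> 1\<close> by simp
  have "lam * x \<notin> real_over_rat.span {x}"
    using assms by (auto simp: real_over_rat.span_breakdown_eq)
  hence "real_over_rat.independent (insert (lam * x) {x})"
    using assms ne by (subst real_over_rat.independent_insert) auto
  thus "real_over_rat.independent {x, lam * x}" by (simp add: insert_commute)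
qed

text \<open>A rational \<open>lam\<close> is its own \<open>p\<close>, with
  \<open>q = r = 0\<close>. Otherwise \<open>c\<close> and \<open>lam * c\<close> are independent
  over the rationals, and functionals with prescribed values turn the symmetry and positivity into
  conditions on the coordinates of \<open>s\<close> and \<open>lam * s\<close>.\<close>

lemma surd_if_bilinear_identity:
  fixes lam c s :: real
  assumes "c > 0"
    and sym: "\<And>f g. rat_linear f \<Longrightarrow> rat_linear g \<Longrightarrow>
      f c * g (lam * c) + f (lam * s) * g s = g c * f (lam * c) + g (lam * s) * f s"
    and psd: "\<And>f. rat_linear f \<Longrightarrow> f c * f (lam * c) + f (lam * s) * f s \<ge> 0"
    and "lam > 0"
  shows "\<exists>p q r. p \<in> \<rat> \<and> q \<in> \<rat> \<and> r \<in> \<rat> \<and> p \<ge> q \<and> q \<ge> r \<and> r \<ge> 0 \<and>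
           (lam = p + sqrt (q\<^sup>2 - r\<^sup>2) \<or> lam = p - sqrt (q\<^sup>2 - r\<^sup>2))"
proof (cases "lam \<in> \<rat>")
  case True
  thus ?thesis using \<open>lam > 0\<close> by (intro exI[of _ lam] exI[of _ 0]) auto
next
  case False
  have indc: "real_over_rat.independent {c, lam * c}" "c \<noteq> lam * c"
    using independent_mult_irrational[of c lam] False \<open>c > 0\<close> by auto
  have extc: "\<exists>f. rat_linear f \<and> f c = x \<and> f (lam * c) = y" for x y
    using real_over_rat.linear_independent_extend[OF indc(1), of "\<lambda>t. if t = c then x else y"] indc(2)
    by auto
  \<comment> \<open>For \<open>s = 0\<close> only \<open>f c * g (lam * c)\<close> would remain,
    which is not symmetric on the dual basis of \<open>c\<close> and \<open>lam * c\<close>.\<close>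
  have "s \<noteq> 0"
  proof
    assume "s = 0"
    obtain f g where "rat_linear f" "f c = 1" "f (lam * c) = 0" "rat_linear g" "g c = 0" "g (lam * c) = 1"
      using extc by metis
    thus False using sym[of f g] real_over_rat.linear_0[of f] real_over_rat.linear_0[of g] \<open>s = 0\<close> by simp
  qed
  have inds: "real_over_rat.independent {s, lam * s}" "s \<noteq> lam * s"
    using independent_mult_irrational[of s lam] False \<open>s \<noteq> 0\<close> by auto
  have exts: "\<exists>f. rat_linear f \<and> f s = x \<and> f (lam * s) = y" for x y
    using real_over_rat.linear_independent_extend[OF inds(1), of "\<lambda>t. if t = s then x else y"] inds(2)
    by auto
  have separate: "\<exists>f. rat_linear f \<and> f c = 0 \<and> f (lam * c) = 0 \<and> f t = 1"
    if "t \<notin> real_over_rat.span {c, lam * c}" for t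
  proof -
    have "t \<noteq> c" "t \<noteq> lam * c" using that real_over_rat.span_base by blast+
    moreover have "real_over_rat.independent (insert t {c, lam * c})"
      using indc that by (subst real_over_rat.independent_insert) auto
    from real_over_rat.linear_independent_extend[OF this, of "\<lambda>u. if u = t then 1 else 0"]
    obtain f where "rat_linear f" "\<forall>u\<in>{t, c, lam * c}. f u = (if u = t then 1 else 0)" by blast
    ultimately show ?thesis by (intro exI[of _ f]) auto
  qed
  have "s \<in> real_over_rat.span {c, lam * c}"
  proof (rule ccontr)
    assume "s \<notin> real_over_rat.span {c, lam * c}"
    from separate[OF this] obtain f where f: "rat_linear f" "f c = 0" "f (lam * c) = 0" "f s = 1" by blast
    \<comment> \<open>With this pair the left side of the symmetry is 0, while the right side is
      \<open>g (lam * s) * f s = 1\<close>.\<close>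
    obtain g where "rat_linear g" "g s = 0" "g (lam * s) = 1" using exts by blast
    thus False using sym[of f g] f by simp
  qed
  then obtain \<alpha> \<beta> where s: "\<alpha> \<in> \<rat>" "\<beta> \<in> \<rat>" "s = \<alpha> * c + \<beta> * (lam * c)"
    by (rule in_span_2)
  have "lam * s \<in> real_over_rat.span {c, lam * c}"
  proof (rule ccontr)
    assume "lam * s \<notin> real_over_rat.span {c, lam * c}"
    from separate[OF this] obtain f where f: "rat_linear f" "f c = 0" "f (lam * c) = 0" "f (lam * s) = 1" by blast
    obtain g where "rat_linear g" "g s = 1" "g (lam * s) = 0" using exts by blast
    thus False using sym[of f g] f by simp
  qed
  then obtain \<gamma> \<delta> where ls: "\<gamma> \<in> \<rat>" "\<delta> \<in> \<rat>" "lam * s = \<gamma> * c + \<delta> * (lam * c)"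
    by (rule in_span_2)
  have coords: "f s = \<alpha> * f c + \<beta> * f (lam * c)" "f (lam * s) = \<gamma> * f c + \<delta> * f (lam * c)"
    if "rat_linear f" for f
    using that s ls by (simp_all add: real_over_rat.linear_add rat_linear_mult)
  have root: "lam * (\<alpha> + \<beta> * lam) = \<gamma> + \<delta> * lam"
  proof -
    have "c * (lam * (\<alpha> + \<beta> * lam)) = lam * s" by (simp add: s(3) algebra_simps)
    also have "\<dots> = c * (\<gamma> + \<delta> * lam)" by (simp add: ls(3) algebra_simps)
    finally show ?thesis using \<open>c > 0\<close> by simp
  qed
  have det: "\<alpha> * \<delta> - \<beta> * \<gamma> = 1"
  proof -
    \<comment> \<open>On the dual basis the symmetry reads
      \<open>1 + \<gamma> * \<beta> = \<delta> * \<alpha>\<close>.\<close>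
    obtain f g where "rat_linear f" "f c = 1" "f (lam * c) = 0" "rat_linear g" "g c = 0" "g (lam * c) = 1"
      using extc by metis
    thus ?thesis using sym[of f g] coords[of f] coords[of g] by (simp add: algebra_simps)
  qed
  have "x * y + (\<gamma> * x + \<delta> * y) * (\<alpha> * x + \<beta> * y) \<ge> 0" for x y
  proof -
    obtain f where "rat_linear f" "f c = x" "f (lam * c) = y" using extc by blast
    thus ?thesis using psd[of f] coords[of f] by simp
  qed
  from quadratic_surd_form[OF s(1,2) ls(1,2) False root det this] show ?thesis .
qed

subsection \<open>Squares of a covering are parallel\<close>

text \<open>As the image of the unit square under the similarity
  \<open>w \<mapsto> a + v * w\<close>, a square of any orientation can be studied in the coordinate
  \<open>(z - a) / v\<close>.\<close>

definition sq :: "complex \<Rightarrow> complex \<Rightarrow> complex set" where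
  "sq a v = (\<lambda>w. a + v * w) ` cbox 0 (Complex 1 1)"

definition corners :: "complex \<Rightarrow> complex \<Rightarrow> complex set" where
  "corners a v = {a, a + v, a + v + \<i> * v, a + \<i> * v}"

lemma convex_hull_corners: "convex hull corners a v = sq a v"
proof
  have "convex (sq a v)"
    unfolding sq_def
    by (subst image_image[of "(+) a" "(*) v", symmetric], intro convex_translation convex_linear_image)
      (auto simp: linear_iff algebra_simps)
  moreover have "corners a v \<subseteq> sq a v"
  proof -
    have "x \<in> sq a v" if "x = a + v * w" "w \<in> cbox 0 (Complex 1 1)" for x w
      using that by (auto simp: sq_def)
    from this[of _ 0] this[of _ 1] this[of _ "1 + \<i>"] this[of _ \<i>] show ?thesis
      by (auto simp: corners_def in_cbox_complex_iff algebra_simps)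
  qed
  ultimately show "convex hull corners a v \<subseteq> sq a v" by (simp add: hull_minimal)
next
  show "sq a v \<subseteq> convex hull corners a v"
  proof
    fix z assume "z \<in> sq a v"
    then obtain w where w: "z = a + v * w" "w \<in> cbox 0 (Complex 1 1)" by (auto simp: sq_def)
    define x y where "x = Re w" and "y = Im w"
    have xy: "0 \<le> x" "x \<le> 1" "0 \<le> y" "y \<le> 1" using w by (auto simp: in_cbox_complex_iff x_def y_def)
    let ?H = "convex hull corners a v"
    have cv: "(1 - t) *\<^sub>R p + t *\<^sub>R q \<in> ?H" if "p \<in> ?H" "q \<in> ?H" "0 \<le> t" "t \<le> 1" for p q t
      using that convexD_alt[OF convex_convex_hull] by blast
    have corner: "p \<in> ?H" if "p \<in> corners a v" for p using that by (rule hull_inc)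
    \<comment> \<open>Bilinear interpolation: first along two opposite sides with parameter
      \<open>x\<close>, then between the two points obtained with parameter
      \<open>y\<close>.\<close>
    have "(1 - y) *\<^sub>R ((1 - x) *\<^sub>R a + x *\<^sub>R (a + v))
      + y *\<^sub>R ((1 - x) *\<^sub>R (a + \<i> * v) + x *\<^sub>R (a + v + \<i> * v)) \<in> ?H"
      by (intro cv xy corner) (auto simp: corners_def)
    also have "(1 - y) *\<^sub>R ((1 - x) *\<^sub>R a + x *\<^sub>R (a + v))
      + y *\<^sub>R ((1 - x) *\<^sub>R (a + \<i> * v) + x *\<^sub>R (a + v + \<i> * v)) = z"
      by (simp add: w(1) complex_eq_iff x_def y_def algebra_simps)
    finally show "z \<in> ?H" .
  qed
qed

lemma mem_sq: "v \<noteq> 0 \<Longrightarrow> z \<in> sq a v \<longleftrightarrow> (z - a) / v \<in> cbox 0 (Complex 1 1)"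
  unfolding sq_def image_iff by (auto intro!: bexI[of _ "(z - a) / v"])

lemma interior_sqI:
  assumes "v \<noteq> 0" "(z - a) / v \<in> box 0 (Complex 1 1)"
  shows "z \<in> interior (sq a v)"
proof (rule interiorI)
  have "open ((\<lambda>z. (z - a) / v) -` box 0 (Complex 1 1))"
    using assms by (intro continuous_open_vimage) (auto intro!: continuous_intros)
  thus "open {z. (z - a) / v \<in> box 0 (Complex 1 1)}" by (simp add: vimage_def)
  show "{z. (z - a) / v \<in> box 0 (Complex 1 1)} \<subseteq> sq a v"
    using assms(1) box_subset_cbox[of 0 "Complex 1 1"] mem_sq[OF assms(1)] by blast
qed (use assms in simp)

lemma eventually_pos_at_right_0:
  fixes a b :: real
  assumes "0 < a \<or> a = 0 \<and> 0 < b"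
  shows "\<forall>\<^sub>F t in at_right 0. 0 < a + t * b"
proof (cases "a = 0")
  case True
  thus ?thesis using assms eventually_at_right_less[of "0::real"] by (auto elim!: eventually_mono)
next
  case False
  have "((\<lambda>t. a + t * b) \<longlongrightarrow> a) (at_right 0)" by (auto intro!: tendsto_eq_intros)
  thus ?thesis using False assms by (auto dest: order_tendstoD(1))
qed

text \<open>\<open>k\<close> is the inward normal of the side through \<open>z\<close>, and
  \<open>Re (w * cnj k)\<close> is the inner product of \<open>w\<close> and \<open>k\<close>. At an
  inner point every direction works and \<open>k = 1\<close> is chosen. At a corner only a
  quarter-plane of directions enters the square, so corners are excluded.\<close>

lemma unit_square_tangent_half_plane:
  assumes z: "z \<in> cbox 0 (Complex 1 1)" "z \<notin> {0, 1, 1 + \<i>, \<i>}"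
  obtains k where "k \<in> {1, -1, \<i>, -\<i>}"
    "\<And>w. Re (w * cnj k) > 0 \<Longrightarrow> \<forall>\<^sub>F t in at_right 0. z + of_real t * w \<in> box 0 (Complex 1 1)"
proof -
  have in_box: "\<forall>\<^sub>F t in at_right 0. z + of_real t * w \<in> box 0 (Complex 1 1)"
    if "0 < Re z \<or> Re z = 0 \<and> 0 < Re w" "0 < 1 - Re z \<or> 1 - Re z = 0 \<and> 0 < - Re w"
      "0 < Im z \<or> Im z = 0 \<and> 0 < Im w" "0 < 1 - Im z \<or> 1 - Im z = 0 \<and> 0 < - Im w" for w
    using eventually_pos_at_right_0[OF that(1)] eventually_pos_at_right_0[OF that(2)]
      eventually_pos_at_right_0[OF that(3)] eventually_pos_at_right_0[OF that(4)]
    by eventually_elim (simp add: in_box_complex_iff)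
  have b: "0 \<le> Re z" "Re z \<le> 1" "0 \<le> Im z" "Im z \<le> 1" using z(1) by (auto simp: in_cbox_complex_iff)
  have "\<not> (Re z = 0 \<and> Im z = 0)" "\<not> (Re z = 1 \<and> Im z = 0)" "\<not> (Re z = 0 \<and> Im z = 1)" "\<not> (Re z = 1 \<and> Im z = 1)"
    using z(2) by (auto simp: complex_eq_iff)
  with b have "Re z = 0 \<and> 0 < Im z \<and> Im z < 1 \<or> Re z = 1 \<and> 0 < Im z \<and> Im z < 1
    \<or> 0 < Re z \<and> Re z < 1 \<and> Im z = 0 \<or> 0 < Re z \<and> Re z < 1 \<and> Im z = 1
    \<or> 0 < Re z \<and> Re z < 1 \<and> 0 < Im z \<and> Im z < 1"
    by argo
  then consider "Re z = 0" "0 < Im z" "Im z < 1" | "Re z = 1" "0 < Im z" "Im z < 1"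
    | "0 < Re z" "Re z < 1" "Im z = 0" | "0 < Re z" "Re z < 1" "Im z = 1"
    | "0 < Re z" "Re z < 1" "0 < Im z" "Im z < 1"
    by blast
  thus thesis
  proof cases
    case 1 thus ?thesis by (intro that[of 1] in_box) auto
  next
    case 2 thus ?thesis by (intro that[of "-1"] in_box) auto
  next
    case 3 thus ?thesis by (intro that[of \<i>] in_box) auto
  next
    case 4 thus ?thesis by (intro that[of "-\<i>"] in_box) auto
  next
    case 5 thus ?thesis by (intro that[of 1] in_box) auto
  qed
qed

lemma square_tangent_half_plane:
  assumes "v \<noteq> 0" "z \<in> sq a v" "z \<notin> corners a v"
  obtains k where "k \<in> {1, -1, \<i>, -\<i>}"
    "\<And>w. Re (w * cnj (k * v)) > 0 \<Longrightarrow> \<forall>\<^sub>F t in at_right 0. z + of_real t * w \<in> interior (sq a v)"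
proof (rule unit_square_tangent_half_plane)
  define c where "c = (z - a) / v"
  show "c \<in> cbox 0 (Complex 1 1)" using assms mem_sq by (simp add: c_def)
  have z: "z = a + v * c" using assms by (simp add: c_def)
  show "c \<notin> {0, 1, 1 + \<i>, \<i>}"
    using assms(3) unfolding z by (auto simp: corners_def algebra_simps)
  fix k assume k: "k \<in> {1, -1, \<i>, -\<i>}"
    "\<And>w. Re (w * cnj k) > 0 \<Longrightarrow> \<forall>\<^sub>F t in at_right 0. c + of_real t * w \<in> box 0 (Complex 1 1)"
  show thesis
  proof (rule that[OF k(1)])
    fix w assume w: "Re (w * cnj (k * v)) > 0"
    \<comment> \<open>Passing to the coordinates of the unit square changes the inner product with
      the normal only by a positive factor.\<close>
    have "w * cnj (k * v) = (cmod v)\<^sup>2 *\<^sub>R (w / v * cnj k)"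
      unfolding scaleR_conv_of_real complex_norm_square using assms(1) by simp
    hence "(cmod v)\<^sup>2 * Re (w / v * cnj k) > 0"
      using w by (simp only: scaleR_complex.sel)
    hence "Re (w / v * cnj k) > 0" by (simp only: zero_less_mult_iff) auto
    from k(2)[OF this] show "\<forall>\<^sub>F t in at_right 0. z + of_real t * w \<in> interior (sq a v)"
    proof eventually_elim
      case (elim t)
      have "(z + of_real t * w - a) / v = c + of_real t * (w / v)"
        using assms(1) by (simp add: z field_simps)
      thus ?case using elim assms(1) by (intro interior_sqI) simp_all
    qed
  qed
qed

text \<open>For nonparallel normals the sum of the two, scaled to equal length, has positive inner
  product with each by the strict Cauchy-Schwarz inequality.\<close>

lemma half_planes_meet:
  assumes "Im (n' * cnj n) \<noteq> 0"
  obtains w where "Re (w * cnj n) > 0" "Re (w * cnj n') > 0"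
proof -
  have strict: "\<bar>Re (p * cnj q)\<bar> < cmod p * cmod q" if "Im (p * cnj q) \<noteq> 0" for p q
  proof -
    have "\<bar>Re (p * cnj q)\<bar>\<^sup>2 < (cmod (p * cnj q))\<^sup>2" using that by (simp add: cmod_power2 del: times_complex.sel)
    thus ?thesis using power2_less_imp_less[of "\<bar>Re (p * cnj q)\<bar>" "cmod (p * cnj q)"]
      by (simp add: norm_mult del: times_complex.sel)
  qed
  have aux: "Re ((of_real (cmod q) * p + of_real (cmod p) * q) * cnj p) > 0"
    if "Im (q * cnj p) \<noteq> 0" for p q
  proof -
    have "p \<noteq> 0" using that by auto
    have "(of_real (cmod q) * p + of_real (cmod p) * q) * cnj p
      = of_real (cmod p) * (of_real (cmod p * cmod q) + q * cnj p)"
      by (simp add: algebra_simps complex_norm_square[symmetric] power2_eq_square[symmetric])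
    moreover have "cmod p * cmod q + Re (q * cnj p) > 0"
      using strict[OF that] by (simp add: mult.commute)
    ultimately show ?thesis using \<open>p \<noteq> 0\<close> by simp
  qed
  have "Im (n * cnj n') \<noteq> 0" using assms by (simp add: algebra_simps)
  from aux[OF assms] aux[OF this] show thesis
    by (intro that[of "of_real (cmod n') * n + of_real (cmod n) * n'"]) (simp_all add: add.commute)
qed

text \<open>The real part of \<open>w * cnj v\<close> is the inner product and the imaginary part
  the determinant, so the vectors are perpendicular or parallel: squares on such sides have the same
  pair of directions.\<close>

definition aligned :: "complex \<Rightarrow> complex \<Rightarrow> bool" where
  "aligned v w \<longleftrightarrow> Re (w * cnj v) = 0 \<or> Im (w * cnj v) = 0"

text \<open>Up to a positive factor, \<open>w * cnj u\<close> is the product of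
  \<open>v * cnj u\<close> and \<open>w * cnj v\<close>, and a product of numbers that are real or
  purely imaginary is again of this kind.\<close>

lemma aligned_trans:
  assumes "aligned u v" "aligned v w" "v \<noteq> 0"
  shows "aligned u w"
proof -
  have "(cmod v)\<^sup>2 *\<^sub>R (w * cnj u) = (v * cnj u) * (w * cnj v)"
    unfolding scaleR_conv_of_real complex_norm_square by (simp add: mult_ac)
  hence "(cmod v)\<^sup>2 * Re (w * cnj u) = Re ((v * cnj u) * (w * cnj v))"
    "(cmod v)\<^sup>2 * Im (w * cnj u) = Im ((v * cnj u) * (w * cnj v))"
    by (metis scaleR_complex.sel)+
  moreover have "Re ((v * cnj u) * (w * cnj v)) = 0 \<or> Im ((v * cnj u) * (w * cnj v)) = 0"
    using assms(1,2) unfolding aligned_def times_complex.sel(1,2)[of "v * cnj u"] by auto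
  ultimately show ?thesis using \<open>v \<noteq> 0\<close> unfolding aligned_def by auto
qed

section \<open>The group generated by the central symmetries and its orbits\<close>

definition shifts :: "real \<Rightarrow> complex set" where
  "shifts lam = {2 * g | g. g \<in> grid lam}"

lemma shifts_iff:
  "g \<in> shifts lam \<longleftrightarrow> (\<exists>m n. g = of_int m * 2 + of_int n * (2 * of_real lam * \<i>))"
proof -
  have "2 * Complex (of_int m) (of_int n * lam) = of_int m * 2 + of_int n * (2 * of_real lam * \<i>)" for m n
    by (simp add: complex_eq_iff)
  from this[symmetric] show ?thesis unfolding shifts_def grid_def mem_Collect_eq by (simp only:) blast
qed

lemma shifts_add:
  assumes "g \<in> shifts lam" "h \<in> shifts lam"
  shows "g + h \<in> shifts lam"
proof -
  obtain m n m' n' where "g = of_int m * 2 + of_int n * (2 * of_real lam * \<i>)"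
    "h = of_int m' * 2 + of_int n' * (2 * of_real lam * \<i>)"
    using assms unfolding shifts_iff by blast
  thus ?thesis unfolding shifts_iff
    by (intro exI[of _ "m + m'"] exI[of _ "n + n'"]) (simp add: algebra_simps)
qed

lemma shifts_uminus:
  assumes "g \<in> shifts lam"
  shows "- g \<in> shifts lam"
proof -
  obtain m n where "g = of_int m * 2 + of_int n * (2 * of_real lam * \<i>)"
    using assms unfolding shifts_iff by blast
  thus ?thesis unfolding shifts_iff
    by (intro exI[of _ "- m"] exI[of _ "- n"]) (simp add: algebra_simps)
qed

lemma shifts_0: "0 \<in> shifts lam"
  unfolding shifts_iff by (intro exI[of _ 0]) simp

text \<open>Each further symmetry exchanges maps of the forms \<open>z + g\<close> and
  \<open>g - z\<close>. Conversely, the symmetry about 0 followed by the one about \<open>c\<close>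
  is the translation by \<open>2 * c\<close>.\<close>

lemma complexly_equivalent_iff:
  "complexly_equivalent lam z w \<longleftrightarrow> (\<exists>g\<in>shifts lam. w = z + g \<or> w = g - z)"
proof
  have "\<exists>g\<in>shifts lam. fold central_symmetry cs z = z + g \<or> fold central_symmetry cs z = g - z"
    if "set cs \<subseteq> grid lam" for cs
    using that
  proof (induction cs rule: rev_induct)
    case Nil
    thus ?case using shifts_0 by force
  next
    case (snoc c cs)
    then obtain g where g: "g \<in> shifts lam"
      "fold central_symmetry cs z = z + g \<or> fold central_symmetry cs z = g - z" by auto
    have c: "2 * c \<in> shifts lam" using snoc by (auto simp: shifts_def)
    have "2 * c + - g \<in> shifts lam" using shifts_add[OF c shifts_uminus[OF g(1)]] .
    moreover have "fold central_symmetry (cs @ [c]) z = 2 * c - fold central_symmetry cs z"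
      by (simp add: central_symmetry_def)
    ultimately show ?case using g(2) by (intro bexI[of _ "2 * c + - g"]) (elim disjE; simp)+
  qed
  thus "complexly_equivalent lam z w \<Longrightarrow> \<exists>g\<in>shifts lam. w = z + g \<or> w = g - z"
    by (auto simp: complexly_equivalent_def)
next
  assume "\<exists>g\<in>shifts lam. w = z + g \<or> w = g - z"
  then obtain c where c: "c \<in> grid lam" "w = z + 2 * c \<or> w = 2 * c - z"
    by (auto simp: shifts_def)
  have "0 \<in> grid lam" by (auto simp: grid_def complex_eq_iff intro!: exI[of _ 0])
  hence "set [0, c] \<subseteq> grid lam" "set [c] \<subseteq> grid lam" using c by auto
  moreover have "w = fold central_symmetry [0, c] z \<or> w = fold central_symmetry [c] z"
    using c by (auto simp: central_symmetry_def)
  ultimately show "complexly_equivalent lam z w" unfolding complexly_equivalent_def by blast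
qed

lemma complexly_equivalent_sym:
  assumes "complexly_equivalent lam z w"
  shows "complexly_equivalent lam w z"
proof -
  obtain g where "g \<in> shifts lam" "w = z + g \<or> w = g - z"
    using assms complexly_equivalent_iff by blast
  hence "z = w + - g \<or> z = g - w" "g \<in> shifts lam" "- g \<in> shifts lam"
    by (auto simp: shifts_uminus)
  thus ?thesis unfolding complexly_equivalent_iff by blast
qed

lemma complexly_equivalent_trans:
  assumes "complexly_equivalent lam x y" "complexly_equivalent lam y z"
  shows "complexly_equivalent lam x z"
proof -
  obtain cs ds where "set cs \<subseteq> grid lam" "y = fold central_symmetry cs x"
    "set ds \<subseteq> grid lam" "z = fold central_symmetry ds y"
    using assms unfolding complexly_equivalent_def by blast
  thus ?thesis unfolding complexly_equivalent_def by (intro exI[of _ "cs @ ds"]) simp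
qed

lemma countable_shifts: "countable (shifts lam)"
proof -
  have "shifts lam \<subseteq> (\<Union>m. \<Union>n. {of_int m * 2 + of_int n * (2 * of_real lam * \<i>)})"
  proof
    fix g assume "g \<in> shifts lam"
    then obtain m n where "g = of_int m * 2 + of_int n * (2 * of_real lam * \<i>)"
      unfolding shifts_iff by blast
    thus "g \<in> (\<Union>m. \<Union>n. {of_int m * 2 + of_int n * (2 * of_real lam * \<i>)})" by blast
  qed
  thus ?thesis by (rule countable_subset) simp
qed

lemma closed_shifts:
  assumes "lam > 0"
  shows "closed (shifts lam)"
proof -
  have "shifts lam = (\<lambda>z. Re z / 2) -` \<int> \<inter> (\<lambda>z. Im z / (2 * lam)) -` \<int>"
  proof (intro equalityI subsetI)
    fix z assume "z \<in> (\<lambda>z. Re z / 2) -` \<int> \<inter> (\<lambda>z. Im z / (2 * lam)) -` \<int>"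
    then obtain m n where "Re z / 2 = of_int m" "Im z / (2 * lam) = of_int n" by (auto elim!: Ints_cases)
    hence "z = of_int m * 2 + of_int n * (2 * of_real lam * \<i>)"
      using assms by (simp add: complex_eq_iff field_simps)
    thus "z \<in> shifts lam" unfolding shifts_iff by blast
  qed (use assms in \<open>auto simp: shifts_iff\<close>)
  moreover have "closed ((\<lambda>z. Re z / 2) -` \<int>)" "closed ((\<lambda>z. Im z / (2 * lam)) -` \<int>)"
    using assms by (intro continuous_closed_vimage closed_Ints; auto intro!: continuous_intros)+
  ultimately show ?thesis by (simp only: closed_Int)
qed

text \<open>The orbit is the union of the sums of the closed lattice with the compact sets
  \<open>S\<close> and \<open>- S\<close>.\<close>

lemma closed_orbit:
  assumes "lam > 0" "compact S"
  shows "closed {z. \<exists>w\<in>S. complexly_equivalent lam z w}"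
proof -
  let ?sum = "\<lambda>T. \<Union>x\<in>T. \<Union>y\<in>shifts lam. {x + y}"
  have "{z. \<exists>w\<in>S. complexly_equivalent lam z w} = ?sum S \<union> ?sum (uminus ` S)"
  proof (intro equalityI subsetI)
    fix z assume "z \<in> {z. \<exists>w\<in>S. complexly_equivalent lam z w}"
    then obtain w g where wg: "w \<in> S" "g \<in> shifts lam" "w = z + g \<or> w = g - z"
      unfolding complexly_equivalent_iff by blast
    from wg(3) show "z \<in> ?sum S \<union> ?sum (uminus ` S)"
    proof
      assume "w = z + g"
      hence "z = w + - g" by simp
      thus ?thesis using wg(1) shifts_uminus[OF wg(2)] by blast
    next
      assume "w = g - z"
      hence "z = - w + g" by simp
      thus ?thesis using wg(1,2) by blast
    qed
  next
    fix z assume "z \<in> ?sum S \<union> ?sum (uminus ` S)"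
    then obtain w g where wg: "w \<in> S" "g \<in> shifts lam" "z = w + g \<or> z = - w + g" by blast
    hence "w = z + - g \<or> w = g - z" by auto
    hence "complexly_equivalent lam z w"
      using wg(2) shifts_uminus[OF wg(2)] unfolding complexly_equivalent_iff by blast
    thus "z \<in> {z. \<exists>w\<in>S. complexly_equivalent lam z w}" using wg(1) by blast
  qed
  moreover have "closed (?sum S)" "closed (?sum (uminus ` S))"
    using closed_shifts[OF assms(1)] assms(2) compact_negations[OF assms(2)]
    by (blast intro: compact_closed_sums)+
  ultimately show ?thesis by (simp only: closed_Un)
qed

lemma countable_orbit:
  assumes "countable P"
  shows "countable {z. \<exists>p\<in>P. complexly_equivalent lam z p}"
proof -
  have "{z. \<exists>p\<in>P. complexly_equivalent lam z p}
    \<subseteq> (\<Union>p\<in>P. \<Union>g\<in>shifts lam. {p - g, g - p})"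
  proof
    fix z assume "z \<in> {z. \<exists>p\<in>P. complexly_equivalent lam z p}"
    then obtain p g where pg: "p \<in> P" "g \<in> shifts lam" "p = z + g \<or> p = g - z"
      unfolding complexly_equivalent_iff by blast
    hence "z = p - g \<or> z = g - p" by auto
    thus "z \<in> (\<Union>p\<in>P. \<Union>g\<in>shifts lam. {p - g, g - p})" using pg by blast
  qed
  moreover have "countable (\<Union>p\<in>P. \<Union>g\<in>shifts lam. {p - g, g - p})"
    using assms countable_shifts by auto
  ultimately show ?thesis by (rule countable_subset)
qed

section \<open>Touching squares of a covering\<close>

lemma covering_interiors:
  assumes cov: "two_sided_covering lam \<Gamma>" and ST: "S \<in> \<Gamma>" "T \<in> \<Gamma>"
    and pq: "p \<in> interior S" "q \<in> interior T" "complexly_equivalent lam p q"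
  shows "p = q" "S = T"
proof -
  have "p \<in> interior (\<Union>\<Gamma>)" "q \<in> interior (\<Union>\<Gamma>)"
    using ST pq interior_mono[of _ "\<Union>\<Gamma>"] by blast+
  thus "p = q" using cov pq unfolding two_sided_covering_def by blast
  thus "S = T" using cov ST pq unfolding two_sided_covering_def by blast
qed

text \<open>The symmetry taking \<open>p\<close> to \<open>q\<close> pulls the tangent half-plane at
  \<open>q\<close> back to \<open>p\<close>. If the sides were not aligned, the two half-planes
  would share a direction, and moving along it would give equivalent interior points of different
  squares.\<close>

lemma covering_squares_aligned_at:
  assumes cov: "two_sided_covering lam \<Gamma>"
    and in\<Gamma>: "sq a v \<in> \<Gamma>" "sq b w \<in> \<Gamma>" and ne: "sq a v \<noteq> sq b w" and "v \<noteq> 0" "w \<noteq> 0"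
    and p: "p \<in> sq a v" "p \<notin> corners a v" and q: "q \<in> sq b w" "q \<notin> corners b w"
    and "complexly_equivalent lam p q"
  shows "aligned v w"
proof (rule ccontr)
  assume not: "\<not> aligned v w"
  obtain k where k: "k \<in> {1, -1, \<i>, -\<i>}"
    "\<And>d. Re (d * cnj (k * v)) > 0 \<Longrightarrow> \<forall>\<^sub>F t in at_right 0. p + of_real t * d \<in> interior (sq a v)"
    using square_tangent_half_plane[OF \<open>v \<noteq> 0\<close> p] by blast
  obtain l where l: "l \<in> {1, -1, \<i>, -\<i>}"
    "\<And>d. Re (d * cnj (l * w)) > 0 \<Longrightarrow> \<forall>\<^sub>F t in at_right 0. q + of_real t * d \<in> interior (sq b w)"
    using square_tangent_half_plane[OF \<open>w \<noteq> 0\<close> q] by blast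
  obtain g where "g \<in> shifts lam" "q = p + g \<or> q = g - p"
    using assms(11) unfolding complexly_equivalent_iff by blast
  \<comment> \<open>\<open>\<sigma>\<close> is the linear part of the symmetry: 1 for a translation
    and - 1 for a point reflection.\<close>
  then obtain \<sigma> where g: "g \<in> shifts lam" "\<sigma> = 1 \<or> \<sigma> = (-1 :: complex)" "q = \<sigma> * p + g"
    by (cases "q = p + g") force+
  \<comment> \<open>The factors \<open>\<sigma>\<close>, \<open>k\<close> and \<open>l\<close> are
    powers of \<open>\<i>\<close>, so they only permute real and imaginary parts up to sign; both
    parts are nonzero since \<open>v\<close> and \<open>w\<close> are not aligned.\<close>
  have "Im ((\<sigma> * (l * w)) * cnj (k * v)) \<noteq> 0"
    using not k(1) l(1) g(2) by (auto simp: aligned_def algebra_simps)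
  then obtain d where d: "Re (d * cnj (k * v)) > 0" "Re (d * cnj (\<sigma> * (l * w))) > 0"
    by (rule half_planes_meet)
  moreover have "\<sigma> * d * cnj (l * w) = d * cnj (\<sigma> * (l * w))" using g(2) by auto
  ultimately have "Re (\<sigma> * d * cnj (l * w)) > 0" by (simp only:)
  from l(2)[OF this] k(2)[OF d(1)] have "\<forall>\<^sub>F t in at_right (0::real). False"
  proof eventually_elim
    case (elim t)
    have "q + of_real t * (\<sigma> * d) = \<sigma> * (p + of_real t * d) + g" by (simp add: g(3) algebra_simps)
    hence "complexly_equivalent lam (p + of_real t * d) (q + of_real t * (\<sigma> * d))"
      unfolding complexly_equivalent_iff using g(1,2) by (intro bexI[of _ g]) auto
    from covering_interiors(2)[OF cov in\<Gamma> elim(2,1) this] show ?case using ne by simp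
  qed
  thus False by (simp add: trivial_limit_at_right_real)
qed

lemma covering_covers:
  assumes "two_sided_covering lam \<Gamma>"
  shows "\<exists>w\<in>\<Union>\<Gamma>. complexly_equivalent lam z w"
  using assms by (simp add: two_sided_covering_def)

text \<open>The orbits of the squares aligned with \<open>S0\<close> and of the other squares form two closed sets
  that cover the plane and meet only in the countable set of corners, whose complement is
  connected; hence one of the two families is empty.\<close>

lemma covering_squares_aligned:
  assumes "lam > 0" and cov: "two_sided_covering lam \<Gamma>"
    and rep: "\<And>S. S \<in> \<Gamma> \<Longrightarrow> V S \<noteq> 0 \<and> sq (A S) (V S) = S"
    and S0: "S0 \<in> \<Gamma>" and "T0 \<in> \<Gamma>"
  shows "aligned (V S0) (V T0)"
proof (rule ccontr)
  assume notpar: "\<not> aligned (V S0) (V T0)"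
  define \<Gamma>1 where "\<Gamma>1 = {S\<in>\<Gamma>. aligned (V S0) (V S)}"
  define orbit where "orbit S = {z. \<exists>w\<in>S. complexly_equivalent lam z w}" for S :: "complex set"
  define K where "K = {z. \<exists>p\<in>(\<Union>S\<in>\<Gamma>. corners (A S) (V S)). complexly_equivalent lam z p}"
  define U where "U = (\<Union>S\<in>\<Gamma>1. orbit S)"
  define W where "W = (\<Union>S\<in>\<Gamma> - \<Gamma>1. orbit S)"
  have "finite \<Gamma>" using cov by (simp add: two_sided_covering_def)
  have "closed (orbit S)" if "S \<in> \<Gamma>" for S
  proof -
    have "compact (sq (A S) (V S))"
      unfolding convex_hull_corners[symmetric]
      by (intro finite_imp_compact_convex_hull) (simp add: corners_def)
    hence "compact S" using rep[OF that] by simp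
    thus ?thesis unfolding orbit_def by (rule closed_orbit[OF \<open>lam > 0\<close>])
  qed
  hence "closed U" "closed W"
    unfolding U_def W_def using \<open>finite \<Gamma>\<close> by (auto simp: \<Gamma>1_def intro!: closed_UN)
  have "countable K"
    unfolding K_def by (rule countable_orbit) (use \<open>finite \<Gamma>\<close> in \<open>auto simp: corners_def intro!: countable_finite\<close>)
  have conn: "connected (UNIV - K)"
    by (rule connected_convex_diff_countable[OF convex_UNIV _ \<open>countable K\<close>])
      (simp add: collinear_aff_dim)
  have covers: "UNIV - K \<subseteq> U \<union> W"
  proof
    fix z
    obtain S w where "S \<in> \<Gamma>" "w \<in> S" "complexly_equivalent lam z w"
      using covering_covers[OF cov, of z] by blast
    thus "z \<in> U \<union> W" unfolding U_def W_def orbit_def by blast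
  qed
  have separated: "U \<inter> W \<inter> (UNIV - K) = {}"
  proof (rule ccontr)
    assume "U \<inter> W \<inter> (UNIV - K) \<noteq> {}"
    then obtain z where z: "z \<in> U" "z \<in> W" "z \<notin> K" by blast
    from z(1) obtain S p where S: "S \<in> \<Gamma>1" "p \<in> S" "complexly_equivalent lam z p"
      by (auto simp: U_def orbit_def)
    from z(2) obtain T q where T: "T \<in> \<Gamma>" "T \<notin> \<Gamma>1" "q \<in> T" "complexly_equivalent lam z q"
      by (auto simp: W_def orbit_def)
    have "S \<in> \<Gamma>" using S by (simp add: \<Gamma>1_def)
    have "p \<notin> corners (A S) (V S)" "q \<notin> corners (A T) (V T)"
      using z(3) S(3) T(4) \<open>S \<in> \<Gamma>\<close> T(1) by (auto simp: K_def)
    moreover have "complexly_equivalent lam p q"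
      by (rule complexly_equivalent_trans[OF complexly_equivalent_sym[OF S(3)] T(4)])
    moreover have "S \<noteq> T" using S(1) T(2) by blast
    ultimately have "aligned (V S) (V T)"
      using covering_squares_aligned_at[OF cov, of "A S" "V S" "A T" "V T" p q]
        rep[OF \<open>S \<in> \<Gamma>\<close>] rep[OF T(1)] S(2) T(1,3) \<open>S \<in> \<Gamma>\<close> by simp
    moreover have "aligned (V S0) (V S)" using S by (simp add: \<Gamma>1_def)
    ultimately have "aligned (V S0) (V T)"
      using aligned_trans[of "V S0" "V S" "V T"] rep[OF \<open>S \<in> \<Gamma>\<close>] by simp
    thus False using T by (simp add: \<Gamma>1_def)
  qed
  \<comment> \<open>A square is uncountable and cannot lie in \<open>K\<close>. Hence both closed
    families still meet the connected complement of \<open>K\<close>.\<close>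
  have orb: "orbit S \<inter> (UNIV - K) \<noteq> {}" if "S \<in> \<Gamma>" for S
  proof -
    have "uncountable (sq (A S) (V S))"
    proof (rule uncountable_convex)
      show "convex (sq (A S) (V S))"
        unfolding convex_hull_corners[symmetric] by (rule convex_convex_hull)
      show "A S \<in> sq (A S) (V S)" "A S + V S \<in> sq (A S) (V S)"
        unfolding convex_hull_corners[symmetric] by (auto simp: corners_def intro!: hull_inc)
      show "A S \<noteq> A S + V S" using rep[OF that] by simp
    qed
    hence "uncountable S" using rep[OF that] by simp
    hence "\<not> S \<subseteq> K" using countable_subset[OF _ \<open>countable K\<close>] by auto
    moreover have "S \<subseteq> orbit S"
    proof
      fix z assume "z \<in> S"
      moreover have "complexly_equivalent lam z z"
        unfolding complexly_equivalent_iff using shifts_0 by (intro bexI[of _ 0]) simp_all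
      ultimately show "z \<in> orbit S" unfolding orbit_def by blast
    qed
    ultimately show ?thesis by blast
  qed
  have "S0 \<in> \<Gamma>1" "T0 \<in> \<Gamma> - \<Gamma>1"
    using S0 \<open>T0 \<in> \<Gamma>\<close> notpar by (auto simp: \<Gamma>1_def aligned_def)
  hence "U \<inter> (UNIV - K) \<noteq> {}" "W \<inter> (UNIV - K) \<noteq> {}"
    using orb[OF S0] orb[OF \<open>T0 \<in> \<Gamma>\<close>] unfolding U_def W_def by blast+
  with connected_closedD[OF conn separated covers] \<open>closed U\<close> \<open>closed W\<close> show False by simp
qed

subsection \<open>Comparison with the fundamental domain\<close>

text \<open>Quarter turns preserve alignment, and exactly one of them brings a nonzero vector into
  the given quadrant. This provides the signs that the L-shaped domain requires of \<open>c\<close>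
  and \<open>s\<close>.\<close>

lemma quadrant_direction:
  assumes "v \<noteq> 0"
  obtains u where "cmod u = 1" "Re u > 0" "Im u \<ge> 0" "aligned u v"
proof -
  note witness = that
  have normalized: thesis if "Re n > 0" "Im n \<ge> 0" "aligned n v" for n
  proof (rule witness)
    have n: "cmod n > 0" using \<open>Re n > 0\<close> by auto
    show "cmod (n /\<^sub>R cmod n) = 1" "Re (n /\<^sub>R cmod n) > 0" "Im (n /\<^sub>R cmod n) \<ge> 0"
      using that n by (simp_all add: zero_less_mult_iff)
    show "aligned (n /\<^sub>R cmod n) v"
      using that(3) n unfolding aligned_def complex_cnj_scaleR mult_scaleR_right by simp
  qed
  consider "Re v > 0 \<and> Im v \<ge> 0" | "Re v \<le> 0 \<and> Im v > 0" | "Re v < 0 \<and> Im v \<le> 0" | "Re v \<ge> 0 \<and> Im v < 0"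
    using assms unfolding complex_eq_iff zero_complex.sel by argo
  thus thesis
  proof cases
    case 1 thus ?thesis by (intro normalized[of v]) (auto simp: aligned_def)
  next
    case 2 thus ?thesis by (intro normalized[of "- \<i> * v"]) (auto simp: aligned_def)
  next
    case 3 thus ?thesis by (intro normalized[of "- v"]) (auto simp: aligned_def)
  next
    case 4 thus ?thesis by (intro normalized[of "\<i> * v"]) (auto simp: aligned_def)
  qed
qed

lemma aligned_square_box:
  assumes "cmod u = 1" "v \<noteq> 0" "aligned u v"
  obtains p s where "s > 0" "\<And>z. z \<in> sq a v \<longleftrightarrow> z * cnj u \<in> cbox p (p + Complex s s)"
proof -
  define \<alpha> where "\<alpha> = a * cnj u"
  define \<kappa> where "\<kappa> = v * cnj u"
  have "cnj u \<noteq> 0" using assms(1) by auto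
  hence "\<kappa> \<noteq> 0" using assms(2) by (simp add: \<kappa>_def)
  have mem: "z \<in> sq a v \<longleftrightarrow> (z * cnj u - \<alpha>) / \<kappa> \<in> cbox 0 (Complex 1 1)" for z
  proof -
    have "(z - a) / v = ((z - a) * cnj u) / (v * cnj u)" using \<open>cnj u \<noteq> 0\<close> by simp
    thus ?thesis using assms(2) by (simp add: mem_sq \<alpha>_def \<kappa>_def left_diff_distrib)
  qed
  \<comment> \<open>In the rotated coordinates the side \<open>\<kappa>\<close> is real or purely
    imaginary. Its type and sign decide which corner of the box \<open>\<alpha>\<close> is;
    \<open>p\<close> is always the lower left one.\<close>
  have "\<exists>p s. s > 0 \<and> (\<forall>w. (w - \<alpha>) / \<kappa> \<in> cbox 0 (Complex 1 1) \<longleftrightarrow> w \<in> cbox p (p + Complex s s))"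
  proof (cases "Im \<kappa> = 0")
    case True
    define k where "k = Re \<kappa>"
    have \<kappa>: "\<kappa> = of_real k" using True by (simp add: k_def complex_eq_iff)
    hence "k \<noteq> 0" using \<open>\<kappa> \<noteq> 0\<close> by auto
    consider "k > 0" | "k < 0" using \<open>k \<noteq> 0\<close> by linarith
    thus ?thesis
    proof cases
      case 1
      thus ?thesis by (intro exI[of _ \<alpha>] exI[of _ k]) (auto simp: \<kappa> in_cbox_complex_iff field_simps)
    next
      case 2
      thus ?thesis
        by (intro exI[of _ "\<alpha> + Complex k k"] exI[of _ "- k"]) (auto simp: \<kappa> in_cbox_complex_iff field_simps)
    qed
  next
    case False
    define k where "k = Im \<kappa>"
    have "k \<noteq> 0" using False by (simp add: k_def)
    have \<kappa>: "\<kappa> = of_real k * \<i>"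
      using assms(3) False by (simp add: k_def complex_eq_iff aligned_def \<kappa>_def)
    have quot: "w / \<kappa> = Complex (Im w / k) (- Re w / k)" for w
      unfolding \<kappa> using \<open>k \<noteq> 0\<close> by (subst nonzero_divide_eq_eq) (simp_all add: complex_eq_iff)
    consider "k > 0" | "k < 0" using \<open>k \<noteq> 0\<close> by linarith
    thus ?thesis
    proof cases
      case 1
      thus ?thesis
        by (intro exI[of _ "\<alpha> - of_real k"] exI[of _ k]) (auto simp: quot in_cbox_complex_iff field_simps)
    next
      case 2
      thus ?thesis
        by (intro exI[of _ "\<alpha> + Complex 0 k"] exI[of _ "- k"]) (auto simp: quot in_cbox_complex_iff field_simps)
    qed
  qed
  thus thesis using mem that by blast
qed

lemma mem_interior_if_rotated_box:
  assumes "\<And>z. z \<in> S \<longleftrightarrow> z * cnj u \<in> cbox lo hi" "z * cnj u \<in> box lo hi"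
  shows "z \<in> interior S"
proof (rule interiorI)
  show "open ((\<lambda>z. z * cnj u) -` box lo hi)"
    by (intro continuous_open_vimage open_box) (auto intro!: continuous_intros)
  show "(\<lambda>z. z * cnj u) -` box lo hi \<subseteq> S" using assms(1) box_subset_cbox by blast
qed (use assms(2) in simp)

text \<open>Multiplication by \<open>cnj u\<close> rotates the generators \<open>2\<close> and
  \<open>2 * lam * \<i>\<close> of the translation lattice to those of the tilted lattice; this is
  why its parameters are twice the coordinates of \<open>u\<close>.\<close>

lemma shifts_rotate:
  assumes "cmod u = 1"
  shows "g \<in> shifts lam \<longleftrightarrow> g * cnj u \<in> tilted_lattice (2 * Re u) (2 * Im u) lam"
proof -
  have "cnj u \<noteq> 0" using assms by auto
  have "of_int m * Complex (2 * Re u) (- (2 * Im u)) + of_int n * Complex (lam * (2 * Im u)) (lam * (2 * Re u))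
    = (of_int m * 2 + of_int n * (2 * of_real lam * \<i>)) * cnj u" for m n
    by (simp add: complex_eq_iff algebra_simps)
  thus ?thesis using \<open>cnj u \<noteq> 0\<close> by (simp add: shifts_iff tilted_lattice_def)
qed

lemma reflected_cbox_iff: "w \<in> cbox (- hi) (- lo) \<longleftrightarrow> - w \<in> cbox lo (hi :: complex)"
  by (auto simp: in_cbox_complex_iff)

lemma reflected_box_iff: "w \<in> box (- hi) (- lo) \<longleftrightarrow> - w \<in> box lo (hi :: complex)"
  by (auto simp: in_box_complex_iff)

text \<open>The group consists of translations and point reflections. Listing each square together
  with its reflection in the origin, marked by \<open>k\<close>, leaves only translations to be
  applied.\<close>

lemma covering_lattice_tiling:
  fixes \<Gamma> :: "complex set set"
  assumes "lam > 0" and cov: "two_sided_covering lam \<Gamma>"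
    and u: "cmod u = 1" "Re u > 0"
    and r: "\<And>S. S \<in> \<Gamma> \<Longrightarrow> r S > 0"
    and sq: "\<And>S z. S \<in> \<Gamma> \<Longrightarrow> z \<in> S \<longleftrightarrow> z * cnj u \<in> cbox (p S) (p S + Complex (r S) (r S))"
  defines "lo \<equiv> \<lambda>(S, k). if k then p S else - (p S + Complex (r S) (r S))"
  defines "hi \<equiv> \<lambda>(S, k). if k then p S + Complex (r S) (r S) else - p S"
  shows "lattice_tiling (tilted_lattice (2 * Re u) (2 * Im u) lam) (\<Gamma> \<times> UNIV) lo hi"
proof (rule lattice_tilingI)
  let ?L = "tilted_lattice (2 * Re u) (2 * Im u) lam"
  define \<sigma> where "\<sigma> k = (if k then 1 else - 1 :: complex)" for k :: bool
  have \<sigma>: "\<sigma> k * \<sigma> k = 1" for k by (simp add: \<sigma>_def)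
  have uu: "u * cnj u = 1" using complex_norm_square[of u] u(1) by simp
  have cbox: "w \<in> cbox (lo (S, k)) (hi (S, k)) \<longleftrightarrow> \<sigma> k * w \<in> cbox (p S) (p S + Complex (r S) (r S))" for w S k
    by (cases k) (simp_all add: lo_def hi_def \<sigma>_def reflected_cbox_iff del: minus_add_distrib)
  have box: "w \<in> box (lo (S, k)) (hi (S, k)) \<longleftrightarrow> \<sigma> k * w \<in> box (p S) (p S + Complex (r S) (r S))" for w S k
    by (cases k) (simp_all add: lo_def hi_def \<sigma>_def reflected_box_iff del: minus_add_distrib)
  show "finite (\<Gamma> \<times> (UNIV :: bool set))" using cov by (simp add: two_sided_covering_def)
  show "finite (?L \<inter> cball 0 R)" for R
    using finite_tilted_lattice_cball[of "2 * Re u" lam] u \<open>lam > 0\<close> by simp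
  show "\<exists>i\<in>\<Gamma> \<times> UNIV. \<exists>g\<in>?L. z - g \<in> cbox (lo i) (hi i)" for z
  proof -
    have z: "z * u * cnj u = z" using uu by (simp add: mult.assoc)
    obtain S w g where w: "S \<in> \<Gamma>" "w \<in> S" "g \<in> shifts lam" "w = z * u + g \<or> w = g - z * u"
      using covering_covers[OF cov, of "z * u"] unfolding complexly_equivalent_iff by blast
    have gu: "g * cnj u \<in> ?L" using w(3) shifts_rotate[OF u(1)] by blast
    have wu: "w * cnj u \<in> cbox (p S) (p S + Complex (r S) (r S))" using sq w(1,2) by blast
    from w(4) show ?thesis
    proof
      assume "w = z * u + g"
      hence "z - - (g * cnj u) = \<sigma> True * (w * cnj u)" using z by (simp add: \<sigma>_def distrib_right)
      hence "z - - (g * cnj u) \<in> cbox (lo (S, True)) (hi (S, True))"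
        using wu unfolding cbox by (simp add: \<sigma>_def)
      thus ?thesis using w(1) tilted_lattice_uminus[OF gu] by blast
    next
      assume "w = g - z * u"
      hence "z - g * cnj u = \<sigma> False * (w * cnj u)" using z by (simp add: \<sigma>_def left_diff_distrib)
      hence "z - g * cnj u \<in> cbox (lo (S, False)) (hi (S, False))"
        using wu unfolding cbox by (simp add: \<sigma>_def)
      thus ?thesis using w(1) gu by blast
    qed
  qed
  fix i j g h z
  assume ij: "i \<in> \<Gamma> \<times> UNIV" "j \<in> \<Gamma> \<times> UNIV" and gh: "g \<in> ?L" "h \<in> ?L"
    and z: "z - g \<in> box (lo i) (hi i)" "z - h \<in> box (lo j) (hi j)"
  obtain S k where i: "i = (S, k)" "S \<in> \<Gamma>" using ij(1) by auto
  obtain T l where j: "j = (T, l)" "T \<in> \<Gamma>" using ij(2) by auto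
  \<comment> \<open>This is needed at every common point \<open>z\<close> of the two translated
    boxes, since the case \<open>k \<noteq> l\<close> uses the whole overlap.\<close>
  have preimages: "\<sigma> k * ((z - g) * u) = \<sigma> l * ((z - h) * u) \<and> S = T"
    if z: "z - g \<in> box (lo i) (hi i)" "z - h \<in> box (lo j) (hi j)" for z
  proof -
    have "\<sigma> k * ((z - g) * u) \<in> interior S"
      by (rule mem_interior_if_rotated_box[OF sq[OF i(2)]])
        (use z(1) uu in \<open>simp add: i(1) box mult.assoc\<close>)
    moreover have "\<sigma> l * ((z - h) * u) \<in> interior T"
      by (rule mem_interior_if_rotated_box[OF sq[OF j(2)]])
        (use z(2) uu in \<open>simp add: j(1) box mult.assoc\<close>)
    moreover have "complexly_equivalent lam (\<sigma> k * ((z - g) * u)) (\<sigma> l * ((z - h) * u))"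
    proof -
      have in_shifts: "g * u \<in> shifts lam" if "g \<in> ?L" for g
        using that uu by (simp add: shifts_rotate[OF u(1)] mult.assoc)
      have "complexly_equivalent lam (z * u) (\<sigma> k * ((z - g) * u))" if "g \<in> ?L" for g k
        using in_shifts[OF that] shifts_uminus[OF in_shifts[OF that]]
        unfolding complexly_equivalent_iff
        by (cases k) (auto simp: \<sigma>_def left_diff_distrib intro: bexI[of _ "- (g * u)"] bexI[of _ "g * u"])
      thus ?thesis using gh complexly_equivalent_sym complexly_equivalent_trans by metis
    qed
    ultimately show ?thesis using covering_interiors[OF cov i(2) j(2)] by blast
  qed
  have "u \<noteq> 0" using u by auto
  have "S = T" using preimages z by blast
  moreover have "k = l \<and> g = h"
  proof (cases "k = l")
    case True
    have "\<sigma> k \<noteq> 0" by (simp add: \<sigma>_def)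
    thus ?thesis using preimages[OF z] True \<open>u \<noteq> 0\<close> by simp
  next
    case False
    \<comment> \<open>Condition (2) leaves room for the fixed point of a reflection, so a common
      point has to be the midpoint of \<open>g\<close> and \<open>h\<close>. An overlap of open
      boxes cannot be a single point.\<close>
    let ?O = "(\<lambda>z. z - g) -` box (lo i) (hi i) \<inter> (\<lambda>z. z - h) -` box (lo j) (hi j)"
    have midpoint: "z' = (g + h) / 2" if "z' \<in> ?O" for z'
    proof -
      have "\<sigma> k * ((z' - g) * u) = \<sigma> l * ((z' - h) * u)" using preimages[of z'] that by blast
      moreover have "\<sigma> k = - \<sigma> l" using False by (auto simp: \<sigma>_def)
      moreover have "\<sigma> l \<noteq> 0" by (simp add: \<sigma>_def)
      ultimately have "- (z' - g) = z' - h" using \<open>u \<noteq> 0\<close>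
        by (metis minus_mult_left minus_mult_right mult_left_cancel mult_right_cancel)
      thus ?thesis by (simp add: field_simps)
    qed
    have "z \<in> ?O" using z by simp
    hence "?O = {z}" using midpoint by blast
    moreover have "open ?O"
      by (intro open_Int continuous_open_vimage open_box) (auto intro!: continuous_intros)
    ultimately show ?thesis using not_open_singleton[of z] by simp
  qed
  ultimately show "i = j \<and> g = h" using i j by simp
qed

text \<open>The squares and their reflections tile modulo the tilted lattice, so their total measure
  is that of the L-shaped domain. Each square and its reflection contribute equally, which gives the
  factor 2.\<close>

lemma covering_identity:
  assumes "lam > 0" and cov: "two_sided_covering lam \<Gamma>"
  obtains c s and r :: "complex set \<Rightarrow> real" where "c > 0"
    "\<And>\<phi> \<psi> :: real \<Rightarrow> real. Modules.additive \<phi> \<Longrightarrow> Modules.additive \<psi> \<Longrightarrow>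
      \<phi> c * \<psi> (lam * c) + \<phi> (lam * s) * \<psi> s = 2 * (\<Sum>S\<in>\<Gamma>. \<phi> (r S) * \<psi> (r S))"
proof -
  have "\<exists>a v. v \<noteq> 0 \<and> sq a v = S" if "S \<in> \<Gamma>" for S
    using cov that unfolding two_sided_covering_def is_square_def corners_def[symmetric] convex_hull_corners
    by metis
  then obtain A V where rep: "\<And>S. S \<in> \<Gamma> \<Longrightarrow> V S \<noteq> 0 \<and> sq (A S) (V S) = S" by metis
  obtain S0 where "S0 \<in> \<Gamma>" using covering_covers[OF cov, of 0] by blast
  obtain u where u: "cmod u = 1" "Re u > 0" "Im u \<ge> 0" "aligned u (V S0)"
    using quadrant_direction rep[OF \<open>S0 \<in> \<Gamma>\<close>] by blast
  have "\<exists>p s. s > 0 \<and> (\<forall>z. z \<in> S \<longleftrightarrow> z * cnj u \<in> cbox p (p + Complex s s))" if "S \<in> \<Gamma>" for S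
  proof -
    have "aligned (V S0) (V S)" by (rule covering_squares_aligned[OF assms rep \<open>S0 \<in> \<Gamma>\<close> that])
    hence "aligned u (V S)" using aligned_trans[OF u(4)] rep[OF \<open>S0 \<in> \<Gamma>\<close>] by blast
    from aligned_square_box[OF u(1) _ this, of "A S"] show ?thesis using rep[OF that] by metis
  qed
  then obtain p r where r: "\<And>S. S \<in> \<Gamma> \<Longrightarrow> r S > 0"
    and sq: "\<And>S z. S \<in> \<Gamma> \<Longrightarrow> z \<in> S \<longleftrightarrow> z * cnj u \<in> cbox (p S) (p S + Complex (r S) (r S))"
    by metis
  show thesis
  proof (rule that[of "2 * Re u" "2 * Im u" r])
    show "2 * Re u > 0" using u by simp
    fix \<phi> \<psi> :: "real \<Rightarrow> real"
    assume add: "Modules.additive \<phi>" "Modules.additive \<psi>"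
    let ?lo = "\<lambda>(S, k). if k then p S else - (p S + Complex (r S) (r S))"
    let ?hi = "\<lambda>(S, k). if k then p S + Complex (r S) (r S) else - p S"
    have "finite \<Gamma>" using cov by (simp add: two_sided_covering_def)
    \<comment> \<open>Additive functions are odd, so the reflected box has the same increments
      \<open>\<phi> (r S)\<close> and \<open>\<psi> (r S)\<close>.\<close>
    have measure: "hmeasure \<phi> \<psi> (?lo (S, k)) (?hi (S, k)) = \<phi> (r S) * \<psi> (r S)" if "S \<in> \<Gamma>" for S k
      using r[OF that] add
      by (simp add: hmeasure_def increment_def Modules.additive.add Modules.additive.minus Modules.additive.diff)
    have "\<phi> (2 * Re u) * \<psi> (lam * (2 * Re u)) + \<phi> (lam * (2 * Im u)) * \<psi> (2 * Im u)
      = (\<Sum>i\<in>\<Gamma> \<times> UNIV. hmeasure \<phi> \<psi> (?lo i) (?hi i))"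
      using u \<open>lam > 0\<close> \<open>finite \<Gamma>\<close> add
      by (intro lattice_tiling_measure[symmetric] covering_lattice_tiling[OF assms u(1,2) r sq]) auto
    also have "\<dots> = (\<Sum>S\<in>\<Gamma>. \<Sum>k\<in>UNIV. hmeasure \<phi> \<psi> (?lo (S, k)) (?hi (S, k)))"
      by (rule sum.cartesian_product')
    also have "\<dots> = (\<Sum>S\<in>\<Gamma>. \<Sum>k\<in>(UNIV :: bool set). \<phi> (r S) * \<psi> (r S))"
      by (intro sum.cong refl measure)
    also have "\<dots> = 2 * (\<Sum>S\<in>\<Gamma>. \<phi> (r S) * \<psi> (r S))"
      by (simp add: sum_distrib_left)
    finally show "\<phi> (2 * Re u) * \<psi> (lam * (2 * Re u)) + \<phi> (lam * (2 * Im u)) * \<psi> (2 * Im u)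
      = 2 * (\<Sum>S\<in>\<Gamma>. \<phi> (r S) * \<psi> (r S))" .
  qed
qed

theorem theorem1:
  fixes lam :: real
  assumes "lam > 0"
    and "\<exists>\<Gamma>. two_sided_covering lam \<Gamma>"
  shows "\<exists>p q r :: real. p \<in> \<rat> \<and> q \<in> \<rat> \<and> r \<in> \<rat> \<and> p \<ge> q \<and> q \<ge> r \<and> r \<ge> 0 \<and>
           (lam = p + sqrt (q\<^sup>2 - r\<^sup>2) \<or> lam = p - sqrt (q\<^sup>2 - r\<^sup>2))"
proof -
  obtain \<Gamma> where cov: "two_sided_covering lam \<Gamma>" using assms(2) by blast
  obtain c s r where "c > 0" and identity: "\<And>\<phi> \<psi> :: real \<Rightarrow> real. Modules.additive \<phi> \<Longrightarrow> Modules.additive \<psi> \<Longrightarrow>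
      \<phi> c * \<psi> (lam * c) + \<phi> (lam * s) * \<psi> s = 2 * (\<Sum>S\<in>\<Gamma>. \<phi> (r S) * \<psi> (r S))"
    using covering_identity[OF assms(1) cov] by blast
  show ?thesis
  proof (rule surd_if_bilinear_identity[OF \<open>c > 0\<close> _ _ \<open>lam > 0\<close>])
    show "f c * g (lam * c) + f (lam * s) * g s = g c * f (lam * c) + g (lam * s) * f s"
      if "rat_linear f" "rat_linear g" for f g
    proof -
      have "(\<Sum>S\<in>\<Gamma>. f (r S) * g (r S)) = (\<Sum>S\<in>\<Gamma>. g (r S) * f (r S))"
        by (simp add: mult.commute)
      with identity[OF that[THEN additive_if_rat_linear]] identity[OF that(2,1)[THEN additive_if_rat_linear]]
      show ?thesis by simp
    qed
    show "f c * f (lam * c) + f (lam * s) * f s \<ge> 0" if "rat_linear f" for f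
      using additive_if_rat_linear[OF that] by (simp add: identity sum_nonneg)
  qed
qed

end
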